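(* Let $H_1,H_2$ be Hermitian matrices, $f_1,f_2:[0,T]\to\mathbb{R}$ with $f_j,f_j',f_j''$ bounded and continuous, $H(t)=f_1(t)H_1+f_2(t)H_2$. Assume $H_1=D_1^\dagger D_1$ for some matrix $D_1$ and that there are constants $\widetilde C_1,\widetilde C_2\ge0$ with $\|[H_1,H_2]\vec v\|\le\widetilde C_1(\|D_1\vec v\|+\|\vec v\|)$ and $\|[H_1,[H_1,H_2]]\vec v\|\le\widetilde C_2(\|H_1\vec v\|+\|\vec v\|)$ for all $\vec v$. Let $\vec\psi(t)=U(t,0)\vec\psi(0)$ be the exact solution, $L$ an integer with $h=T/L\le(\|f_1\|_\infty+\|f_2\|_\infty)^{-1}(\widetilde C_1+\|H_2\|)^{-1}/2$, and for each scheme $X\in\{(s,1),(g,1),(s,2),(g,2)\}$ let $\mathcal U_X=U_X(T,\tfrac{(L-1)T}{L})\cdots U_X(\tfrac TL,0)$. Then there exists a constant $\widetilde C$ (independent of $H_1$, $L$, $\vec\psi$) such that $$\|\mathcal U_{s,1}\vec\psi(0)-U(T,0)\vec\psi(0)\|\le\widetilde C\tfrac{T^2}{L}\Big(\sup_{t\in[0,T]}\|H_1\vec\psi(t)\|+\|\vec\psi(0)\|\Big),$$ $$\|\mathcal U_{g,1}\vec\psi(0)-U(T,0)\vec\psi(0)\|\le\widetilde C\tfrac{T^2}{L}\Big(\sup_{t\in[0,T]}\sqrt{\|\vec\psi(0)\|\|H_1\vec\psi(t)\|}+\|\vec\psi(0)\|\Big),$$ $$\|\mathcal U_{s,2}\vec\psi(0)-U(T,0)\vec\psi(0)\|\le\widetilde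 C\tfrac{T^3}{L^2}\Big(\sup_{t\in[0,T]}\|H_1\vec\psi(t)\|+\|\vec\psi(0)\|\Big),$$ $$\|\mathcal U_{g,2}\vec\psi(0)-U(T,0)\vec\psi(0)\|\le\widetilde C\tfrac{T^3}{L^2}\Big(\sup_{t\in[0,T]}\|H_1\vec\psi(t)\|+\|\vec\psi(0)\|\Big).$$
   Context: $\|\cdot\|$ is the vector 2-norm / induced operator norm, $\|f\|_\infty=\sup_{[0,T]}|f|$. The constant $\widetilde C$ may depend polynomially on $\|H_2\|$, $\|f_j^{(k)}\|_\infty$ ($k\le2$) and on $\widetilde C_1,\widetilde C_2$, but not on $H_1$. $U(t,s)$ is the exact evolution: $\partial_tU(t,s)=-\mathrm{i} H(t)U(t,s)$, $U(s,s)=I$. Trotter steps: $U_{s,1}(t+h,t)=\exp(-\mathrm{i} f_2(t+h)H_2h)\exp(-\mathrm{i} f_1(t+h)H_1h)$; $U_{g,1}(t+h,t)=\exp(-\mathrm{i}\int_t^{t+h}f_2(s)ds\,H_2)\exp(-\mathrm{i}\int_t^{t+h}f_1(s)ds\,H_1)$; $U_{s,2}(t+h,t)=\exp(-\frac{\mathrm{i} h}{2}f_1(t+h/2)H_1)\exp(-\mathrm{i} hf_2(t+h/2)H_2)\exp(-\frac{\mathrm{i} h}{2}f_1(t+h/2)H_1)$; $U_{g,2}(t+h,t)=\exp(-\mathrm{i}\int_{t+h/2}^{t+h}f_1(s)ds\,H_1)\exp(-\mathrm{i}\int_t^{t+h}f_2(s)ds\,H_2)\exp(-\mathrm{i}\int_t^{t+h/2}f_1(s)ds\,H_1)$.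 *)

theory Defs
  imports "HOL-Analysis.Analysis"
begin


text \<open>Conjugate transpose (dagger).\<close>
definition adj :: "complex ^ 'n::finite ^ 'm::finite \<Rightarrow> complex ^ 'm ^ 'n" where
  "adj A = (\<chi> i j. cnj (A $ j $ i))"

definition hermitian :: "complex ^ ('n::finite) ^ 'n \<Rightarrow> bool" where
  "hermitian A \<longleftrightarrow> adj A = A"

text \<open>Commutator of matrices.\<close>
definition comm :: "complex ^ ('n::finite) ^ 'n \<Rightarrow> complex ^ ('n::finite) ^ 'n \<Rightarrow> complex ^ ('n::finite) ^ 'n" where
  "comm A B = A ** B - B ** A"

text \<open>Operator (induced 2-)norm of a matrix.\<close>
definition opnorm :: "complex ^ ('n::finite) ^ 'n \<Rightarrow> real" where
  "opnorm A = onorm (\<lambda>v::complex ^ ('n::finite). A *v v)"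

text \<open>Action of the matrix exponential exp(c A) on a vector v, via its power series.\<close>
definition expm :: "complex \<Rightarrow> complex ^ ('n::finite) ^ 'n \<Rightarrow> complex ^ ('n::finite) \<Rightarrow> complex ^ ('n::finite)" where
  "expm c A v = (\<Sum>k. (c ^ k / of_nat (fact k)) *s (((\<lambda>w. A *v w) ^^ k) v))"

text \<open>Sup norm on [0,T].\<close>
definition supnorm :: "real \<Rightarrow> (real \<Rightarrow> real) \<Rightarrow> real" where
  "supnorm T f = (SUP t\<in>{0..T}. \<bar>f t\<bar>)"

text \<open>Trotter steps: step f1 f2 H1 H2 t h v = U_X(t+h,t) v.\<close>
definition step_s1 :: "(real \<Rightarrow> real) \<Rightarrow> (real \<Rightarrow> real) \<Rightarrow> complex ^ ('n::finite) ^ 'n \<Rightarrow> complex ^ ('n::finite) ^ 'n \<Rightarrow> real \<Rightarrow> real \<Rightarrow> complex ^ ('n::finite) \<Rightarrow> complex ^ ('n::finite)" where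
  "step_s1 f1 f2 H1 H2 t h v =
     expm (- \<i> * of_real (f2 (t + h) * h)) H2 (expm (- \<i> * of_real (f1 (t + h) * h)) H1 v)"

definition step_g1 :: "(real \<Rightarrow> real) \<Rightarrow> (real \<Rightarrow> real) \<Rightarrow> complex ^ ('n::finite) ^ 'n \<Rightarrow> complex ^ ('n::finite) ^ 'n \<Rightarrow> real \<Rightarrow> real \<Rightarrow> complex ^ ('n::finite) \<Rightarrow> complex ^ ('n::finite)" where
  "step_g1 f1 f2 H1 H2 t h v =
     expm (- \<i> * of_real (integral {t..t+h} f2)) H2 (expm (- \<i> * of_real (integral {t..t+h} f1)) H1 v)"

definition step_s2 :: "(real \<Rightarrow> real) \<Rightarrow> (real \<Rightarrow> real) \<Rightarrow> complex ^ ('n::finite) ^ 'n \<Rightarrow> complex ^ ('n::finite) ^ 'n \<Rightarrow> real \<Rightarrow> real \<Rightarrow> complex ^ ('n::finite) \<Rightarrow> complex ^ ('n::finite)" where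
  "step_s2 f1 f2 H1 H2 t h v =
     expm (- \<i> * of_real (h / 2 * f1 (t + h / 2))) H1
       (expm (- \<i> * of_real (h * f2 (t + h / 2))) H2
         (expm (- \<i> * of_real (h / 2 * f1 (t + h / 2))) H1 v))"

definition step_g2 :: "(real \<Rightarrow> real) \<Rightarrow> (real \<Rightarrow> real) \<Rightarrow> complex ^ ('n::finite) ^ 'n \<Rightarrow> complex ^ ('n::finite) ^ 'n \<Rightarrow> real \<Rightarrow> real \<Rightarrow> complex ^ ('n::finite) \<Rightarrow> complex ^ ('n::finite)" where
  "step_g2 f1 f2 H1 H2 t h v =
     expm (- \<i> * of_real (integral {t+h/2..t+h} f1)) H1
       (expm (- \<i> * of_real (integral {t..t+h} f2)) H2
         (expm (- \<i> * of_real (integral {t..t+h/2} f1)) H1 v))"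

text \<open>Product formula: steps S k h v = S((k-1)h,h) ... S(0,h) v,
  i.e. U_X(kh,(k-1)h) ... U_X(h,0) v.\<close>
primrec steps :: "(real \<Rightarrow> real \<Rightarrow> 'a \<Rightarrow> 'a) \<Rightarrow> nat \<Rightarrow> real \<Rightarrow> 'a \<Rightarrow> 'a" where
  "steps S 0 h v = v"
| "steps S (Suc k) h v = S (real k * h) h (steps S k h v)"

end

theory Submission
  imports Defs
begin

text \<open>
  The Trotter steps are products of unitaries, so the global error telescopes into at most \<open>L\<close>
  local errors, each committed along the exact solution on a step of length \<open>h = T / L\<close>.

  A local error is the increment of an interaction picture: the exact solution with the factors
  of the current step undone. Its derivative involves \<open>H1\<close> only through the phase errors of the
  splitting and through commutators with the \<open>H2\<close>-factors. As
  \<open>\<parallel>D1 v\<parallel>\<^sup>2 = \<langle>v, H1 v\<rangle> \<le> \<parallel>v\<parallel> \<parallel>H1 v\<parallel>\<close>, the hypothesis on \<open>[H1, H2]\<close>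
  bounds these commutators by \<open>\<parallel>H1 \<psi>\<parallel> + \<parallel>\<psi>\<parallel>\<close>, or by \<open>sqrt (\<parallel>\<psi>\<parallel> \<parallel>H1 \<psi>\<parallel>) + \<parallel>\<psi>\<parallel>\<close>
  for the generalized first-order scheme, whose phases are exact; an energy estimate shows that
  the \<open>H2\<close>-factors increase \<open>\<parallel>D1 v\<parallel>\<close> only linearly in time. For the symmetric schemes the
  leading part of the derivative is proportional to the distance from the midpoint of the step and
  integrates to zero, leaving a remainder controlled by \<open>[H1, [H1, H2]]\<close>; the standard Strang step
  differs from the generalized one by midpoint-rule phase errors of order \<open>h\<^sup>3\<close>.
\<close>

section \<open>Complex vectors and matrices\<close>

lemma norm_vector_smult: "norm (c *s v) = norm c * norm (v :: complex ^ 'n)"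
  by (simp add: norm_vec_def L2_set_right_distrib norm_mult)

lemma matrix_vector_mult_smult: "(A :: complex ^ 'n ^ 'm) *v (c *s v) = c *s (A *v v)"
  by (simp add: vec_eq_iff matrix_vector_mult_def sum_distrib_left ac_simps)

lemma matrix_vector_mult_scaleR_right: "(A :: complex ^ 'n ^ 'm) *v (r *\<^sub>R v) = r *\<^sub>R (A *v v)"
  by (simp add: vec_eq_iff matrix_vector_mult_def scaleR_sum_right)

lemma matrix_vector_mult_scaleR_left: "(r *\<^sub>R A) *v (v :: complex ^ 'n) = r *\<^sub>R (A *v v)"
  by (simp add: vec_eq_iff matrix_vector_mult_def scaleR_sum_right)

lemma matrix_vector_mult_uminus: "(A :: complex ^ 'n ^ 'm) *v (- v) = - (A *v v)"
  by (simp add: vec_eq_iff matrix_vector_mult_def sum_negf)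

lemma scaleR_vector_smult: "r *\<^sub>R (v :: complex ^ 'n) = complex_of_real r *s v"
  unfolding vec_eq_iff vector_scaleR_component vector_smult_component by (simp add: scaleR_conv_of_real)

lemma norm_matrix_vector_le_opnorm: "norm ((A :: complex ^ 'n ^ 'n) *v v) \<le> opnorm A * norm v"
  unfolding opnorm_def by (rule onorm) simp

lemma opnorm_nonneg: "opnorm (A :: complex ^ 'n ^ 'n) \<ge> 0"
  unfolding opnorm_def by (rule onorm_pos_le) simp

lemma bounded_bilinear_vector_smult: "bounded_bilinear (\<lambda>(c :: complex) (v :: complex ^ 'n). c *s v)"
proof
  show "\<exists>K. \<forall>c (v :: complex ^ 'n). norm (c *s v) \<le> norm c * norm v * K"
    by (rule exI[of _ 1]) (simp add: norm_vector_smult)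
qed (simp_all add: vec_eq_iff algebra_simps)

lemmas bounded_linear_vector_smult = bounded_bilinear.bounded_linear_right[OF bounded_bilinear_vector_smult]
lemmas bounded_linear_vector_smult_scalar = bounded_bilinear.bounded_linear_left[OF bounded_bilinear_vector_smult]

lemma has_vector_derivative_componentwise:
  fixes f :: "real \<Rightarrow> complex ^ 'n"
  assumes "\<And>j. ((\<lambda>x. f x $ j) has_vector_derivative f' $ j) F"
  shows "(f has_vector_derivative f') F"
proof -
  have "((\<lambda>x. \<Sum>j\<in>UNIV. (f x $ j) *s axis j 1) has_vector_derivative (\<Sum>j\<in>UNIV. (f' $ j) *s axis j 1)) F"
    by (intro has_vector_derivative_sum bounded_linear.has_vector_derivative[OF bounded_linear_vector_smult_scalar assms])
  then show ?thesis by (simp add: basis_expansion)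
qed

lemma complex_linear_basis_expansion:
  assumes "bounded_linear (L :: complex ^ 'n \<Rightarrow> complex ^ 'n)" and "\<And>c w. L (c *s w) = c *s L w"
  shows "L u = (\<Sum>j\<in>UNIV. (u $ j) *s L (axis j 1))"
proof -
  have "L u = L (\<Sum>j\<in>UNIV. (u $ j) *s axis j 1)" by (simp add: basis_expansion)
  also have "\<dots> = (\<Sum>j\<in>UNIV. (u $ j) *s L (axis j 1))"
    by (simp add: linear_sum[OF bounded_linear.linear[OF assms(1)]] assms(2))
  finally show ?thesis .
qed

lemma has_vector_derivative_bound:
  fixes f :: "real \<Rightarrow> 'a :: real_normed_vector"
  assumes "\<And>x. x \<in> closed_segment a b \<Longrightarrow> (f has_vector_derivative f' x) (at x within closed_segment a b)"
    and "\<And>x. x \<in> closed_segment a b \<Longrightarrow> norm (f' x) \<le> B"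
  shows "norm (f b - f a) \<le> B * \<bar>b - a\<bar>"
proof -
  have "norm (f b - f a) \<le> B * norm (b - a)"
  proof (rule differentiable_bound[where f' = "\<lambda>x h. h *\<^sub>R f' x"])
    show "onorm (\<lambda>h. h *\<^sub>R f' x) \<le> B" if "x \<in> closed_segment a b" for x
      using assms(2)[OF that] by (intro onorm_le) (simp add: mult_left_mono mult.commute[of _ "\<bar>_\<bar>"])
  qed (use assms(1) in \<open>auto simp: has_vector_derivative_def\<close>)
  then show ?thesis by simp
qed

lemma has_real_derivative_bound:
  fixes f :: "real \<Rightarrow> real"
  assumes "\<And>x. x \<in> closed_segment a b \<Longrightarrow> (f has_real_derivative f' x) (at x within closed_segment a b)"
    and "\<And>x. x \<in> closed_segment a b \<Longrightarrow> \<bar>f' x\<bar> \<le> B"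
  shows "\<bar>f b - f a\<bar> \<le> B * \<bar>b - a\<bar>"
  using has_vector_derivative_bound[of a b f f' B] assms
  by (simp add: has_real_derivative_iff_has_vector_derivative)

lemma inner_complex_vec: "inner (x :: complex ^ 'n) y = Re (\<Sum>i\<in>UNIV. x $ i * cnj (y $ i))"
  by (simp add: inner_vec_def inner_complex_def Re_sum)

lemma inner_matrix_vector_adj: "inner ((A :: complex ^ 'n ^ 'm) *v v) w = inner v (adj A *v w)"
proof -
  have "(\<Sum>i\<in>UNIV. (A *v v) $ i * cnj (w $ i)) = (\<Sum>i\<in>UNIV. \<Sum>j\<in>UNIV. A $ i $ j * v $ j * cnj (w $ i))"
    by (simp add: matrix_vector_mult_def sum_distrib_right)
  also have "\<dots> = (\<Sum>j\<in>UNIV. \<Sum>i\<in>UNIV. A $ i $ j * v $ j * cnj (w $ i))"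
    by (rule sum.swap)
  also have "\<dots> = (\<Sum>j\<in>UNIV. v $ j * cnj ((adj A *v w) $ j))"
    by (simp add: matrix_vector_mult_def adj_def sum_distrib_left ac_simps)
  finally show ?thesis by (simp add: inner_complex_vec)
qed

lemma hermitian_inner: "hermitian H \<Longrightarrow> inner (H *v v) w = inner v (H *v w)"
  by (simp add: inner_matrix_vector_adj hermitian_def)

lemma hermitian_scaleR_add:
  "hermitian A \<Longrightarrow> hermitian B \<Longrightarrow> hermitian ((r :: real) *\<^sub>R A + (s :: real) *\<^sub>R B)"
  by (simp add: hermitian_def adj_def vec_eq_iff)

lemma comm_matrix_vector_mult: "comm A B *v v = A *v (B *v v) - B *v (A *v v)"
  by (simp add: comm_def matrix_vector_mult_diff_rdistrib matrix_vector_mul_assoc)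

lemma comm_swap_matrix_vector_mult: "comm B A *v v = - (comm A B *v v)"
  by (simp add: comm_matrix_vector_mult)

text \<open>Multiplication by \<open>\<i>\<close>, as an opaque real-linear map: this lets \<open>algebra_simps\<close>
  normalise expressions in which it occurs.\<close>

definition J :: "complex ^ 'n \<Rightarrow> complex ^ 'n" where
  "J v = \<i> *s v"

lemma J_add: "J (v + w) = J v + J w" by (simp add: J_def vector_add_ldistrib)
lemma J_diff: "J (v - w) = J v - J w" by (simp add: J_def vector_ssub_ldistrib)
lemma J_minus: "J (- v) = - J v" by (simp add: J_def)
lemma J_scaleR: "J (r *\<^sub>R v) = r *\<^sub>R J v" by (simp add: J_def vec_eq_iff)
lemma J_J: "J (J v) = - v" by (simp add: J_def vec_eq_iff)
lemma J_zero: "J 0 = 0" by (simp add: J_def)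
lemma matrix_vector_mult_J: "A *v J v = J (A *v v)" by (simp add: J_def matrix_vector_mult_smult)
lemma norm_J: "norm (J v) = norm v" by (simp add: J_def norm_vector_smult)

lemmas J_simps = J_add J_diff J_minus J_scaleR J_J J_zero matrix_vector_mult_J

lemma inner_J_right: "inner v (J w) = - inner (J v) w"
  by (simp add: J_def inner_complex_vec sum_subtractf)

lemma hermitian_inner_J: "hermitian H \<Longrightarrow> inner v (J (H *v v)) = 0"
proof -
  assume herm: "hermitian H"
  have "inner v (J (H *v v)) = - inner (H *v J v) v"
    using hermitian_inner[OF herm, of "J v" v] by (simp add: inner_J_right inner_commute)
  also have "\<dots> = - inner v (J (H *v v))"
    by (simp add: matrix_vector_mult_J inner_commute)
  finally show ?thesis by simp
qed

section \<open>The unitary group generated by a Hermitian matrix\<close>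

definition evolve :: "complex ^ 'n ^ 'n \<Rightarrow> real \<Rightarrow> complex ^ 'n \<Rightarrow> complex ^ 'n" where
  "evolve A y v = expm (- \<i> * complex_of_real y) A v"

lemma norm_funpow_matrix_vector_le: "norm (((*v) A ^^ k) v) \<le> opnorm A ^ k * norm v"
proof (induction k)
  case (Suc k)
  have "norm (((*v) A ^^ Suc k) v) \<le> opnorm A * norm (((*v) A ^^ k) v)"
    by (simp add: norm_matrix_vector_le_opnorm)
  also have "\<dots> \<le> opnorm A * (opnorm A ^ k * norm v)"
    using Suc opnorm_nonneg by (intro mult_left_mono)
  finally show ?case by (simp add: ac_simps)
qed simp

lemma summable_expm_series:
  "summable (\<lambda>k. ((c :: complex) ^ k / of_nat (fact k)) *s ((*v) (A :: complex ^ 'n ^ 'n) ^^ k) v)"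
proof (rule summable_norm_cancel, rule summable_comparison_test')
  show "summable (\<lambda>k. (norm c * opnorm A) ^ k / fact k * norm v)"
    using summable_exp_generic[of "norm c * opnorm A"] by (simp add: divide_inverse ac_simps summable_mult2)
  show "norm (norm ((c ^ k / of_nat (fact k)) *s ((*v) A ^^ k) v))
      \<le> (norm c * opnorm A) ^ k / fact k * norm v" for k
  proof -
    have "norm ((c ^ k / of_nat (fact k)) *s ((*v) A ^^ k) v) = norm c ^ k / fact k * norm (((*v) A ^^ k) v)"
      by (simp add: norm_vector_smult norm_divide norm_power)
    also have "\<dots> \<le> norm c ^ k / fact k * (opnorm A ^ k * norm v)"
      by (intro mult_left_mono norm_funpow_matrix_vector_le) auto
    finally show ?thesis by (simp add: power_mult_distrib)
  qed
qed

lemma expm_nth_power_series: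
  "expm c A v $ j = (\<Sum>k. (((*v) A ^^ k) v $ j / of_nat (fact k)) * c ^ k)"
  unfolding expm_def bounded_linear.suminf[OF bounded_linear_vec_nth summable_expm_series]
  by (simp add: ac_simps)

lemma expm_nth_has_field_derivative:
  "((\<lambda>c. expm c A v $ j) has_field_derivative (A *v expm c A v) $ j) (at c)"
proof -
  define a where "a k = ((*v) A ^^ k) v $ j / of_nat (fact k)" for k
  have summable: "summable (\<lambda>k. a k * z ^ k)" for z
    using bounded_linear.summable[OF bounded_linear_vec_nth summable_expm_series]
    by (simp add: a_def ac_simps)
  have "(A *v expm c A v) $ j = (\<Sum>k. (A *v ((c ^ k / of_nat (fact k)) *s ((*v) A ^^ k) v)) $ j)"
    unfolding expm_def
    bounded_linear.suminf[OF matrix_vector_mul_bounded_linear summable_expm_series]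
    bounded_linear.suminf[OF bounded_linear_vec_nth
        bounded_linear.summable[OF matrix_vector_mul_bounded_linear summable_expm_series]] ..
  also have "\<dots> = (\<Sum>k. diffs a k * c ^ k)"
  proof (rule suminf_cong)
    fix k
    have "(of_nat (Suc k) :: complex) * (x / fact (Suc k)) = x / fact k" for x
      by (simp add: divide_simps del: of_nat_Suc)
    then have "diffs a k = (A *v ((*v) A ^^ k) v) $ j / fact k"
      by (simp add: diffs_def a_def del: fact_Suc)
    then show "(A *v ((c ^ k / of_nat (fact k)) *s ((*v) A ^^ k) v)) $ j = diffs a k * c ^ k"
      by (simp add: matrix_vector_mult_smult)
  qed
  finally have "(A *v expm c A v) $ j = (\<Sum>k. diffs a k * c ^ k)" .
  moreover have "((\<lambda>c. \<Sum>k. a k * c ^ k) has_field_derivative (\<Sum>k. diffs a k * c ^ k)) (at c)"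
    by (rule termdiffs_strong'[where K = "norm c + 1"]) (auto intro: summable)
  ultimately show ?thesis
    by (simp add: expm_nth_power_series a_def)
qed

lemma evolve_has_vector_derivative:
  "((\<lambda>y. evolve A y v) has_vector_derivative - J (A *v evolve A y v)) (at y within S)"
proof (rule has_vector_derivative_componentwise)
  fix j
  have "((\<lambda>z. expm (- \<i> * z) A v $ j) has_field_derivative
      (A *v expm (- \<i> * complex_of_real y) A v) $ j * (- \<i>)) (at (complex_of_real y))"
    by (rule DERIV_chain2[OF expm_nth_has_field_derivative]) (auto intro!: derivative_eq_intros)
  from has_vector_derivative_real_field[OF this]
  show "((\<lambda>y. evolve A y v $ j) has_vector_derivative (- J (A *v evolve A y v)) $ j) (at y within S)"
    by (simp add: evolve_def J_def mult.commute)
qed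

lemma evolve_0 [simp]: "evolve A 0 v = v"
proof -
  have "(\<lambda>k. ((- \<i> * complex_of_real 0) ^ k / of_nat (fact k)) *s ((*v) A ^^ k) v)
      = (\<lambda>k. if k = 0 then ((*v) A ^^ k) v else 0)"
    by (auto simp: fun_eq_iff)
  then show ?thesis
    using sums_single[of 0 "\<lambda>k. ((*v) A ^^ k) v"] by (simp add: evolve_def expm_def sums_iff)
qed

lemma hermitian_flow_norm_eq:
  fixes w :: "real \<Rightarrow> complex ^ 'n"
  assumes deriv: "\<And>x. x \<in> closed_segment a b \<Longrightarrow>
      (w has_vector_derivative - J (B x *v w x)) (at x within closed_segment a b)"
    and herm: "\<And>x. x \<in> closed_segment a b \<Longrightarrow> hermitian (B x)"
  shows "norm (w b) = norm (w a)"
proof -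
  have "norm (inner (w b) (w b) - inner (w a) (w a)) \<le> 0 * \<bar>b - a\<bar>"
  proof (rule has_vector_derivative_bound)
    fix x assume x: "x \<in> closed_segment a b"
    show "((\<lambda>x. inner (w x) (w x)) has_vector_derivative
        inner (w x) (- J (B x *v w x)) + inner (- J (B x *v w x)) (w x)) (at x within closed_segment a b)"
      by (rule bounded_bilinear.has_vector_derivative[OF bounded_bilinear_inner deriv[OF x] deriv[OF x]])
    show "norm (inner (w x) (- J (B x *v w x)) + inner (- J (B x *v w x)) (w x)) \<le> 0"
      using hermitian_inner_J[OF herm[OF x], of "w x"] by (simp add: inner_commute)
  qed
  then show ?thesis by (simp add: norm_eq_sqrt_inner)
qed

lemma evolve_norm: "hermitian A \<Longrightarrow> norm (evolve A y v) = norm v"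
  using hermitian_flow_norm_eq[of 0 y "\<lambda>y. evolve A y v" "\<lambda>_. A"]
  by (simp add: evolve_has_vector_derivative)

lemma evolve_unique:
  assumes herm: "hermitian A"
    and deriv: "\<And>y. (u has_vector_derivative - J (A *v u y)) (at y)"
  shows "u y = evolve A y (u 0)"
proof -
  define d where "d = (\<lambda>y. u y - evolve A y (u 0))"
  have "(d has_vector_derivative - J (A *v d y)) (at y within S)" for y S
    unfolding d_def
    by (rule has_vector_derivative_eq_rhs[OF has_vector_derivative_diff
          [OF has_vector_derivative_at_within[OF deriv] evolve_has_vector_derivative]])
      (simp add: matrix_vector_mult_diff_distrib J_simps)
  then have "norm (d y) = norm (d 0)"
    using hermitian_flow_norm_eq[of 0 y d "\<lambda>_. A"] herm by blast
  then show ?thesis by (simp add: d_def)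
qed

context
  fixes A :: "complex ^ 'n ^ 'n"
  assumes herm: "hermitian A"
begin

lemma evolve_add: "evolve A y (v + w) = evolve A y v + evolve A y w"
proof -
  have "((\<lambda>y. evolve A y v + evolve A y w) has_vector_derivative
      - J (A *v (evolve A y v + evolve A y w))) (at y)" for y
    by (rule has_vector_derivative_eq_rhs[OF has_vector_derivative_add
          [OF evolve_has_vector_derivative evolve_has_vector_derivative]])
      (simp add: matrix_vector_right_distrib J_simps)
  from evolve_unique[OF herm this] show ?thesis by simp
qed

lemma evolve_smult: "evolve A y (c *s v) = c *s evolve A y v"
proof -
  have "((\<lambda>y. c *s evolve A y v) has_vector_derivative - J (A *v (c *s evolve A y v))) (at y)" for y
    by (rule has_vector_derivative_eq_rhs[OF bounded_linear.has_vector_derivative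
          [OF bounded_linear_vector_smult evolve_has_vector_derivative]])
      (simp add: J_def matrix_vector_mult_smult vector_smult_assoc mult.commute vector_smult_rneg)
  from evolve_unique[OF herm this] show ?thesis by simp
qed

lemma evolve_commute: "A *v evolve A y v = evolve A y (A *v v)"
proof -
  have "((\<lambda>y. A *v evolve A y v) has_vector_derivative - J (A *v (A *v evolve A y v))) (at y)" for y
    by (rule has_vector_derivative_eq_rhs[OF bounded_linear.has_vector_derivative
          [OF matrix_vector_mul_bounded_linear evolve_has_vector_derivative]])
      (simp add: matrix_vector_mult_uminus J_simps)
  from evolve_unique[OF herm this] show ?thesis by simp
qed

lemma evolve_add_time: "evolve A y (evolve A z v) = evolve A (y + z) v"
proof -
  have "((\<lambda>y. y + z) has_vector_derivative 1) (at y)" for y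
    by (auto intro!: derivative_eq_intros)
  from vector_diff_chain_within[OF this evolve_has_vector_derivative]
  have "((\<lambda>y. evolve A (y + z) v) has_vector_derivative - J (A *v evolve A (y + z) v)) (at y)" for y
    by (simp add: o_def)
  from evolve_unique[OF herm this] show ?thesis by simp
qed

lemma evolve_zero [simp]: "evolve A y 0 = 0"
  using evolve_norm[OF herm, of y 0] by simp

lemma evolve_minus: "evolve A y (- v) = - evolve A y v"
  using evolve_add[of y v "- v"] by (simp add: eq_neg_iff_add_eq_0 add.commute)

lemma evolve_diff: "evolve A y (v - w) = evolve A y v - evolve A y w"
  using evolve_add[of y v "- w"] evolve_minus[of y w] by simp

lemma evolve_scaleR: "evolve A y (r *\<^sub>R v) = r *\<^sub>R evolve A y v"
  by (simp add: scaleR_vector_smult evolve_smult)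

lemma evolve_J: "evolve A y (J v) = J (evolve A y v)"
  by (simp add: J_def evolve_smult)

lemma evolve_inverse: "evolve A (- y) (evolve A y v) = v"
  by (simp add: evolve_add_time)

lemma evolve_inverse': "evolve A y (evolve A (- y) v) = v"
  by (simp add: evolve_add_time)

lemma bounded_linear_evolve: "bounded_linear (evolve A y)"
  by (rule bounded_linear_intro[where K = 1]) (auto simp: evolve_add evolve_scaleR evolve_norm[OF herm])

lemma norm_evolve_diff_time_le: "norm (evolve A x v - evolve A y v) \<le> norm (A *v v) * \<bar>x - y\<bar>"
  by (rule has_vector_derivative_bound[OF evolve_has_vector_derivative])
    (simp add: norm_J evolve_commute evolve_norm[OF herm])

lemma evolve_has_vector_derivative_chain:
  assumes dx: "(x has_real_derivative x') (at t within S)"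
    and du: "(u has_vector_derivative u') (at t within S)"
  shows "((\<lambda>t. evolve A (x t) (u t)) has_vector_derivative
      evolve A (x t) u' - x' *\<^sub>R J (A *v evolve A (x t) (u t))) (at t within S)"
proof -
  define L where "L w = - (x' *\<^sub>R J (A *v evolve A (x t) w))" for w
  have "bounded_linear L"
    unfolding L_def J_def
    by (intro bounded_linear_minus bounded_linear_compose[OF bounded_linear_scaleR_right]
        bounded_linear_compose[OF bounded_linear_vector_smult]
        bounded_linear_compose[OF matrix_vector_mul_bounded_linear] bounded_linear_evolve)
  moreover have "L (c *s w) = c *s L w" for c w
    by (simp add: L_def J_def evolve_smult matrix_vector_mult_smult vector_smult_assoc
        scaleR_conv_of_real vec_eq_iff)
  ultimately have L: "L w = (\<Sum>j\<in>UNIV. (w $ j) *s L (axis j 1))" for w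
    by (rule complex_linear_basis_expansion)
  have U: "evolve A y w = (\<Sum>j\<in>UNIV. (w $ j) *s evolve A y (axis j 1))" for y w
    by (rule complex_linear_basis_expansion[OF bounded_linear_evolve evolve_smult])
  have "((\<lambda>s. (u s $ j) *s evolve A (x s) (axis j 1)) has_vector_derivative
      (u t $ j) *s L (axis j 1) + (u' $ j) *s evolve A (x t) (axis j 1)) (at t within S)" for j
  proof (rule bounded_bilinear.has_vector_derivative[OF bounded_bilinear_vector_smult])
    show "((\<lambda>s. u s $ j) has_vector_derivative u' $ j) (at t within S)"
      by (rule bounded_linear.has_vector_derivative[OF bounded_linear_vec_nth du])
    show "((\<lambda>s. evolve A (x s) (axis j 1)) has_vector_derivative L (axis j 1)) (at t within S)"
      using vector_diff_chain_within[OF dx[unfolded has_real_derivative_iff_has_vector_derivative]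
          evolve_has_vector_derivative]
      by (simp add: o_def L_def)
  qed
  then have "((\<lambda>s. \<Sum>j\<in>UNIV. (u s $ j) *s evolve A (x s) (axis j 1)) has_vector_derivative
      (\<Sum>j\<in>UNIV. (u t $ j) *s L (axis j 1) + (u' $ j) *s evolve A (x t) (axis j 1))) (at t within S)"
    by (rule has_vector_derivative_sum)
  then show ?thesis
    by (simp only: sum.distrib flip: L U) (simp add: L_def)
qed

lemma inner_evolve_has_real_derivative:
  "((\<lambda>s. inner (evolve A s w) (B *v evolve A s w)) has_real_derivative
      inner (evolve A s w) (J (comm A B *v evolve A s w))) (at s within S)"
proof -
  let ?x = "evolve A s w"
  have "((\<lambda>s. inner (evolve A s w) (B *v evolve A s w)) has_vector_derivative
      inner ?x (B *v - J (A *v ?x)) + inner (- J (A *v ?x)) (B *v ?x)) (at s within S)"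
    by (rule bounded_bilinear.has_vector_derivative[OF bounded_bilinear_inner
          evolve_has_vector_derivative bounded_linear.has_vector_derivative
          [OF matrix_vector_mul_bounded_linear evolve_has_vector_derivative]])
  moreover have "inner (J (A *v ?x)) (B *v ?x) = - inner ?x (J (A *v (B *v ?x)))"
    using hermitian_inner[OF herm, of ?x "J (B *v ?x)"] inner_J_right[of "A *v ?x" "B *v ?x"]
    by (simp add: matrix_vector_mult_J)
  ultimately show ?thesis
    by (simp add: has_real_derivative_iff_has_vector_derivative comm_matrix_vector_mult
        matrix_vector_mult_uminus J_simps inner_diff_right)
qed

lemma evolve_conj_has_vector_derivative:
  "((\<lambda>s. evolve A s (B *v evolve A (- s) w)) has_vector_derivative
      - J (evolve A s (comm A B *v evolve A (- s) w))) (at s within S)"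
proof -
  have "(uminus has_vector_derivative - 1) (at s within S)"
    by (auto intro!: derivative_eq_intros)
  from vector_diff_chain_within[OF this evolve_has_vector_derivative]
  have "((\<lambda>s. evolve A (- s) w) has_vector_derivative J (A *v evolve A (- s) w)) (at s within S)"
    by (simp add: o_def)
  then have "((\<lambda>s. B *v evolve A (- s) w) has_vector_derivative B *v J (A *v evolve A (- s) w)) (at s within S)"
    by (rule bounded_linear.has_vector_derivative[OF matrix_vector_mul_bounded_linear])
  from evolve_has_vector_derivative_chain[of "\<lambda>s. s" 1, OF _ this]
  show ?thesis
    by (simp add: comm_matrix_vector_mult evolve_commute evolve_diff evolve_J J_simps)
qed

lemma norm_evolve_conj_diff_le:
  assumes bound: "\<And>s. \<bar>s\<bar> \<le> \<bar>t\<bar> \<Longrightarrow> norm (comm A B *v evolve A s w) \<le> K"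
  shows "norm (evolve A t (B *v evolve A (- t) w) - B *v w) \<le> K * \<bar>t\<bar>"
proof -
  have "norm (evolve A t (B *v evolve A (- t) w) - evolve A 0 (B *v evolve A (- 0) w)) \<le> K * \<bar>t - 0\<bar>"
  proof (rule has_vector_derivative_bound[OF evolve_conj_has_vector_derivative])
    fix s assume "s \<in> closed_segment 0 t"
    then have "\<bar>- s\<bar> \<le> \<bar>t\<bar>" by (auto simp: closed_segment_eq_real_ivl split: if_splits)
    then show "norm (- J (evolve A s (comm A B *v evolve A (- s) w))) \<le> K"
      by (simp add: norm_J evolve_norm[OF herm] bound)
  qed
  then show ?thesis by simp
qed

end

section \<open>Commutator estimates\<close>

locale commutator_bounds =
  fixes H1 H2 D1 :: "complex ^ 'n::finite ^ 'n" and C1 C2 :: real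
  assumes herm1: "hermitian H1" and herm2: "hermitian H2"
    and H1_eq: "H1 = adj D1 ** D1"
    and comm_bound1: "\<And>v. norm (comm H1 H2 *v v) \<le> C1 * (norm (D1 *v v) + norm v)"
    and comm_bound2: "\<And>v. norm (comm H1 (comm H1 H2) *v v) \<le> C2 * (norm (H1 *v v) + norm v)"
    and C1_nonneg: "C1 \<ge> 0" and C2_nonneg: "C2 \<ge> 0"
begin

lemmas evolve_H1_simps = evolve_norm[OF herm1] evolve_add[OF herm1] evolve_diff[OF herm1]
  evolve_minus[OF herm1] evolve_scaleR[OF herm1] evolve_J[OF herm1] evolve_zero[OF herm1]
lemmas evolve_H2_simps = evolve_norm[OF herm2] evolve_add[OF herm2] evolve_diff[OF herm2]
  evolve_minus[OF herm2] evolve_scaleR[OF herm2] evolve_J[OF herm2] evolve_zero[OF herm2]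

lemma norm_D1_squared: "(norm (D1 *v v))\<^sup>2 = inner v (H1 *v v)"
  by (simp add: H1_eq power2_norm_eq_inner inner_matrix_vector_adj matrix_vector_mul_assoc[symmetric])

lemma norm_D1_le_sqrt: "norm (D1 *v v) \<le> sqrt (norm v * norm (H1 *v v))"
proof -
  have "(norm (D1 *v v))\<^sup>2 \<le> norm v * norm (H1 *v v)"
    unfolding norm_D1_squared by (rule norm_cauchy_schwarz)
  then show ?thesis by (simp add: real_le_rsqrt)
qed

lemma norm_D1_le_mean: "2 * norm (D1 *v v) \<le> norm v + norm (H1 *v v)"
  using norm_D1_le_sqrt[of v] arith_geo_mean_sqrt[of "norm v" "norm (H1 *v v)"] by simp

lemma norm_comm_le: "norm (comm H1 H2 *v v) \<le> 2 * C1 * (norm (H1 *v v) + norm v)"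
proof -
  have "norm (D1 *v v) + norm v \<le> 2 * norm (H1 *v v) + 2 * norm v"
    using norm_D1_le_mean[of v] norm_ge_zero[of v] norm_ge_zero[of "H1 *v v"] by linarith
  then have "C1 * (norm (D1 *v v) + norm v) \<le> 2 * C1 * (norm (H1 *v v) + norm v)"
    using mult_left_mono[OF _ C1_nonneg] by (fastforce simp: algebra_simps)
  with comm_bound1[of v] show ?thesis
    by (rule order_trans)
qed

lemma norm_H1_evolve_H1: "norm (H1 *v evolve H1 t w) = norm (H1 *v w)"
  by (simp add: evolve_commute[OF herm1] evolve_H1_simps)

text \<open>Along \<open>x(s) = exp(-i s H2) w\<close> the derivative of \<open>\<parallel>D1 x\<parallel>\<^sup>2 = \<langle>x, H1 x\<rangle>\<close> is the
  expectation of \<open>i [H2, H1]\<close>, which \<open>comm_bound1\<close> bounds by \<open>2 C1 \<parallel>x\<parallel> sqrt (\<parallel>D1 x\<parallel>\<^sup>2 + \<parallel>x\<parallel>\<^sup>2)\<close>.\<close>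

lemma sqrt_energy_evolve_H2_diff_le:
  assumes "w \<noteq> 0"
  shows "\<bar>sqrt ((norm (D1 *v evolve H2 t w))\<^sup>2 + (norm w)\<^sup>2) - sqrt ((norm (D1 *v w))\<^sup>2 + (norm w)\<^sup>2)\<bar>
    \<le> norm w * C1 * \<bar>t\<bar>"
proof -
  define r where "r = norm w"
  define x where "x s = evolve H2 s w" for s
  define q where "q s = sqrt ((norm (D1 *v x s))\<^sup>2 + r\<^sup>2)" for s
  have r: "r > 0" using assms by (simp add: r_def)
  have norm_x: "norm (x s) = r" for s by (simp add: x_def r_def evolve_H2_simps)
  have q_ge: "norm (D1 *v x s) \<le> q s" "r \<le> q s" for s
    using r by (simp_all add: q_def real_le_rsqrt)
  have pos: "0 < (norm (D1 *v x s))\<^sup>2 + r\<^sup>2" for s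
    using r by (simp add: add_nonneg_pos)
  have energy: "((\<lambda>s. (norm (D1 *v x s))\<^sup>2 + r\<^sup>2) has_real_derivative
      inner (x s) (J (comm H2 H1 *v x s))) (at s within S)" for s S
    unfolding norm_D1_squared x_def
    using DERIV_add[OF inner_evolve_has_real_derivative[OF herm2] DERIV_const[of "r\<^sup>2"]] by simp
  have dq: "(q has_real_derivative inverse (q s) / 2 * inner (x s) (J (comm H2 H1 *v x s)))
      (at s within S)" for s S
    unfolding q_def by (rule DERIV_chain2[OF DERIV_real_sqrt[OF pos[of s]] energy])
  have bound: "\<bar>inverse (q s) / 2 * inner (x s) (J (comm H2 H1 *v x s))\<bar> \<le> r * C1" for s
  proof -
    have "\<bar>inner (x s) (J (comm H2 H1 *v x s))\<bar> \<le> norm (x s) * norm (J (comm H2 H1 *v x s))"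
      by (rule Cauchy_Schwarz_ineq2)
    also have "\<dots> = r * norm (comm H1 H2 *v x s)"
      by (simp add: norm_x norm_J comm_swap_matrix_vector_mult[of H2 H1])
    also have "\<dots> \<le> r * (C1 * (norm (D1 *v x s) + r))"
      using comm_bound1[of "x s"] r by (intro mult_left_mono) (simp_all add: norm_x)
    also have "\<dots> \<le> r * C1 * (2 * q s)"
      using mult_left_mono[of "norm (D1 *v x s) + r" "2 * q s" "r * C1"] q_ge[of s] r C1_nonneg
      by (simp add: mult.assoc)
    finally show ?thesis
      using pos[of s] by (simp add: q_def abs_mult field_simps)
  qed
  have "\<bar>q t - q 0\<bar> \<le> r * C1 * \<bar>t - 0\<bar>"
    by (rule has_real_derivative_bound[OF dq bound])
  then show ?thesis by (simp add: q_def x_def r_def)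
qed

lemma norm_D1_evolve_H2_le: "norm (D1 *v evolve H2 t w) \<le> norm (D1 *v w) + norm w * (1 + C1 * \<bar>t\<bar>)"
proof (cases "w = 0")
  case True
  then show ?thesis by (simp add: evolve_H2_simps)
next
  case False
  have "norm (D1 *v evolve H2 t w) \<le> sqrt ((norm (D1 *v evolve H2 t w))\<^sup>2 + (norm w)\<^sup>2)"
    by (simp add: real_le_rsqrt)
  also have "\<dots> \<le> sqrt ((norm (D1 *v w))\<^sup>2 + (norm w)\<^sup>2) + norm w * C1 * \<bar>t\<bar>"
    using sqrt_energy_evolve_H2_diff_le[OF False, of t] by linarith
  also have "sqrt ((norm (D1 *v w))\<^sup>2 + (norm w)\<^sup>2) \<le> norm (D1 *v w) + norm w"
    using sqrt_add_le_add_sqrt[of "(norm (D1 *v w))\<^sup>2" "(norm w)\<^sup>2"] by simp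
  finally show ?thesis by (simp add: algebra_simps)
qed

lemma norm_evolve_H2_conj_H1_diff_le:
  "norm (evolve H2 (- t) (H1 *v evolve H2 t w) - H1 *v w)
    \<le> C1 * (norm (D1 *v w) + norm w * (2 + C1 * \<bar>t\<bar>)) * \<bar>t\<bar>"
proof -
  have "norm (comm H2 H1 *v evolve H2 s w) \<le> C1 * (norm (D1 *v w) + norm w * (2 + C1 * \<bar>t\<bar>))"
    if "\<bar>s\<bar> \<le> \<bar>- t\<bar>" for s
  proof -
    have "norm (comm H2 H1 *v evolve H2 s w) \<le> C1 * (norm (D1 *v evolve H2 s w) + norm w)"
      using comm_bound1[of "evolve H2 s w"] by (simp add: comm_swap_matrix_vector_mult[of H2 H1] evolve_H2_simps)
    also have "\<dots> \<le> C1 * (norm (D1 *v w) + norm w * (2 + C1 * \<bar>t\<bar>))"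
    proof (rule mult_left_mono[OF _ C1_nonneg])
      have "norm w * (C1 * \<bar>s\<bar>) \<le> norm w * (C1 * \<bar>t\<bar>)"
        using that C1_nonneg by (simp add: mult_left_mono)
      then show "norm (D1 *v evolve H2 s w) + norm w \<le> norm (D1 *v w) + norm w * (2 + C1 * \<bar>t\<bar>)"
        using norm_D1_evolve_H2_le[of s w] by (simp add: algebra_simps)
    qed
    finally show ?thesis .
  qed
  from norm_evolve_conj_diff_le[OF herm2 this, of "- t"] show ?thesis by simp
qed

lemma norm_evolve_H1_conj_H2_expansion_le:
  "norm (evolve H1 t (H2 *v evolve H1 (- t) w) - H2 *v w + t *\<^sub>R J (comm H1 H2 *v w))
    \<le> C2 * (norm (H1 *v w) + norm w) * t\<^sup>2"
proof -
  define f where "f s = evolve H1 s (H2 *v evolve H1 (- s) w) + s *\<^sub>R J (comm H1 H2 *v w)" for s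
  have "(f has_vector_derivative
      - J (evolve H1 s (comm H1 H2 *v evolve H1 (- s) w)) + 1 *\<^sub>R J (comm H1 H2 *v w)) (at s within S)"
    for s S
    unfolding f_def
    by (intro has_vector_derivative_add evolve_conj_has_vector_derivative[OF herm1]
        has_vector_derivative_scaleR[of "\<lambda>s. s" 1, THEN has_vector_derivative_eq_rhs]
        has_vector_derivative_const) auto
  then have df: "(f has_vector_derivative
      - J (evolve H1 s (comm H1 H2 *v evolve H1 (- s) w) - comm H1 H2 *v w)) (at s within S)" for s S
    by (simp add: J_simps)
  have "norm (f t - f 0) \<le> (C2 * (norm (H1 *v w) + norm w) * \<bar>t\<bar>) * \<bar>t - 0\<bar>"
  proof (rule has_vector_derivative_bound[OF df])
    fix s assume s: "s \<in> closed_segment 0 t"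
    have "norm (evolve H1 s (comm H1 H2 *v evolve H1 (- s) w) - comm H1 H2 *v w)
        \<le> C2 * (norm (H1 *v w) + norm w) * \<bar>s\<bar>"
      using comm_bound2[of "evolve H1 _ w"]
      by (intro norm_evolve_conj_diff_le[OF herm1]) (simp add: norm_H1_evolve_H1 evolve_H1_simps)
    also have "\<dots> \<le> C2 * (norm (H1 *v w) + norm w) * \<bar>t\<bar>"
      using s C2_nonneg by (intro mult_left_mono) (auto simp: closed_segment_eq_real_ivl split: if_splits)
    finally show "norm (- J (evolve H1 s (comm H1 H2 *v evolve H1 (- s) w) - comm H1 H2 *v w))
        \<le> C2 * (norm (H1 *v w) + norm w) * \<bar>t\<bar>"
      by (simp add: norm_J)
  qed
  then show ?thesis by (simp add: f_def power2_eq_square abs_mult_self mult.assoc diff_add_eq)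
qed

definition comm_evolve_bound :: "complex ^ 'n \<Rightarrow> real \<Rightarrow> real" where
  "comm_evolve_bound y b = C1 * ((norm y + norm (H1 *v y)) / 2 + norm y * (2 + C1 * \<bar>b\<bar>)) * \<bar>b\<bar>"

lemma comm_evolve_bound_nonneg: "comm_evolve_bound y b \<ge> 0"
  unfolding comm_evolve_bound_def using C1_nonneg by simp

lemma norm_H1_evolve_H2_comm_le:
  "norm (H1 *v evolve H2 b y - evolve H2 b (H1 *v y)) \<le> comm_evolve_bound y b"
proof -
  have "norm (H1 *v evolve H2 b y - evolve H2 b (H1 *v y))
      = norm (evolve H2 (- b) (H1 *v evolve H2 b y - evolve H2 b (H1 *v y)))"
    by (rule evolve_norm[OF herm2, symmetric])
  also have "\<dots> = norm (evolve H2 (- b) (H1 *v evolve H2 b y) - H1 *v y)"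
    by (simp add: evolve_H2_simps evolve_inverse[OF herm2])
  also have "\<dots> \<le> C1 * (norm (D1 *v y) + norm y * (2 + C1 * \<bar>b\<bar>)) * \<bar>b\<bar>"
    by (rule norm_evolve_H2_conj_H1_diff_le)
  also have "\<dots> \<le> comm_evolve_bound y b"
    unfolding comm_evolve_bound_def using norm_D1_le_mean[of y] C1_nonneg
    by (intro mult_right_mono mult_left_mono add_right_mono) auto
  finally show ?thesis .
qed

lemma norm_evolve_H1_conj_evolve_H2_diff_le:
  "norm (evolve H1 (- d) (evolve H2 b (evolve H1 d y)) - evolve H2 b y) \<le> comm_evolve_bound y b * \<bar>d\<bar>"
proof -
  define f where "f = (\<lambda>s. evolve H1 (- s) (evolve H2 b (evolve H1 s y)))"
  have "(f has_vector_derivative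
      J (evolve H1 (- s) (H1 *v evolve H2 b (evolve H1 s y) - evolve H2 b (H1 *v evolve H1 s y))))
      (at s within S)" for s S
  proof -
    have du: "((\<lambda>s. evolve H2 b (evolve H1 s y)) has_vector_derivative
        evolve H2 b (- J (H1 *v evolve H1 s y))) (at s within S)"
      by (rule bounded_linear.has_vector_derivative[OF bounded_linear_evolve[OF herm2]
            evolve_has_vector_derivative])
    have dx: "(uminus has_real_derivative - 1) (at s within S)"
      by (auto intro!: derivative_eq_intros)
    from evolve_has_vector_derivative_chain[OF herm1 dx du] show ?thesis
      unfolding f_def by (simp add: evolve_H1_simps evolve_H2_simps evolve_commute[OF herm1] J_simps algebra_simps)
  qed
  then have "norm (f d - f 0) \<le> comm_evolve_bound y b * \<bar>d - 0\<bar>"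
  proof (rule has_vector_derivative_bound)
    fix s
    have "norm (J (evolve H1 (- s) (H1 *v evolve H2 b (evolve H1 s y) - evolve H2 b (H1 *v evolve H1 s y))))
        = norm (H1 *v evolve H2 b (evolve H1 s y) - evolve H2 b (H1 *v evolve H1 s y))"
      by (simp add: norm_J evolve_norm[OF herm1])
    also have "\<dots> \<le> comm_evolve_bound (evolve H1 s y) b"
      by (rule norm_H1_evolve_H2_comm_le)
    also have "\<dots> = comm_evolve_bound y b"
      by (simp add: comm_evolve_bound_def evolve_H1_simps norm_H1_evolve_H1)
    finally show "norm (J (evolve H1 (- s) (H1 *v evolve H2 b (evolve H1 s y)
        - evolve H2 b (H1 *v evolve H1 s y)))) \<le> comm_evolve_bound y b" .
  qed
  then show ?thesis by (simp add: f_def)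
qed

lemma norm_splitting_perturbation_le:
  "norm (evolve H1 (\<alpha> + \<epsilon>) (evolve H1 (- \<delta>) (evolve H2 b (evolve H1 \<delta> y))) - evolve H1 \<alpha> (evolve H2 \<beta> y))
    \<le> \<bar>\<epsilon>\<bar> * (norm (H1 *v y) + comm_evolve_bound y b) + comm_evolve_bound y b * \<bar>\<delta>\<bar>
      + opnorm H2 * norm y * \<bar>b - \<beta>\<bar>"
proof -
  define z where "z = evolve H1 (- \<delta>) (evolve H2 b (evolve H1 \<delta> y))"
  have "norm (H1 *v z) \<le> norm (H1 *v y) + comm_evolve_bound y b"
  proof -
    have "norm (H1 *v z) = norm (H1 *v evolve H2 b (evolve H1 \<delta> y))"
      by (simp add: z_def norm_H1_evolve_H1)
    also have "\<dots> \<le> norm (evolve H2 b (H1 *v evolve H1 \<delta> y))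
        + norm (H1 *v evolve H2 b (evolve H1 \<delta> y) - evolve H2 b (H1 *v evolve H1 \<delta> y))"
      by (rule norm_triangle_sub)
    also have "\<dots> \<le> norm (H1 *v y) + comm_evolve_bound y b"
      using norm_H1_evolve_H2_comm_le[of b "evolve H1 \<delta> y"]
      by (simp add: evolve_H1_simps evolve_H2_simps norm_H1_evolve_H1 comm_evolve_bound_def)
    finally show ?thesis .
  qed
  then have "norm (H1 *v z) * \<bar>\<epsilon>\<bar> \<le> (norm (H1 *v y) + comm_evolve_bound y b) * \<bar>\<epsilon>\<bar>"
    by (rule mult_right_mono[OF _ abs_ge_zero])
  then have "norm (evolve H1 (\<alpha> + \<epsilon>) z - evolve H1 \<alpha> z) \<le> \<bar>\<epsilon>\<bar> * (norm (H1 *v y) + comm_evolve_bound y b)"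
    using norm_evolve_diff_time_le[OF herm1, of "\<alpha> + \<epsilon>" z \<alpha>] by (simp add: mult.commute)
  moreover have "norm (evolve H1 \<alpha> (z - evolve H2 b y)) \<le> comm_evolve_bound y b * \<bar>\<delta>\<bar>"
    using norm_evolve_H1_conj_evolve_H2_diff_le[of \<delta> b y] by (simp add: z_def evolve_norm[OF herm1])
  moreover have "norm (evolve H1 \<alpha> (evolve H2 b y - evolve H2 \<beta> y)) \<le> opnorm H2 * norm y * \<bar>b - \<beta>\<bar>"
    using norm_evolve_diff_time_le[OF herm2, of b y \<beta>]
      mult_right_mono[OF norm_matrix_vector_le_opnorm[of H2 y] abs_ge_zero[of "b - \<beta>"]]
    by (simp add: evolve_norm[OF herm1])
  moreover have "evolve H1 (\<alpha> + \<epsilon>) z - evolve H1 \<alpha> (evolve H2 \<beta> y)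
      = (evolve H1 (\<alpha> + \<epsilon>) z - evolve H1 \<alpha> z) + evolve H1 \<alpha> (z - evolve H2 b y)
        + evolve H1 \<alpha> (evolve H2 b y - evolve H2 \<beta> y)"
    by (simp add: evolve_H1_simps)
  ultimately show ?thesis
    unfolding z_def[symmetric] by (smt (verit) norm_triangle_ineq)
qed

end

section \<open>Real-variable estimates\<close>

lemma le_mult_mono_const: "x \<le> K * a * M \<Longrightarrow> K \<le> C \<Longrightarrow> 0 \<le> a \<Longrightarrow> 0 \<le> (M :: real) \<Longrightarrow> x \<le> C * a * M"
  by (meson mult_right_mono order_trans)

lemma abs_le_supnorm:
  assumes "continuous_on {0..T} f" and "t \<in> {0..T}"
  shows "\<bar>f t\<bar> \<le> supnorm T f"
  unfolding supnorm_def
  by (intro cSUP_upper assms(2) bounded_imp_bdd_above compact_imp_bounded compact_continuous_image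
      continuous_on_rabs assms(1) compact_Icc)

lemma taylor_linear_remainder_bound:
  fixes g :: "real \<Rightarrow> real"
  assumes S: "convex S"
    and g: "\<And>x. x \<in> S \<Longrightarrow> (g has_real_derivative g' x) (at x within S)"
    and g': "\<And>x. x \<in> S \<Longrightarrow> (g' has_real_derivative g'' x) (at x within S)"
    and g'': "\<And>x. x \<in> S \<Longrightarrow> \<bar>g'' x\<bar> \<le> c"
    and s: "s \<in> S" and m: "m \<in> S"
  shows "\<bar>g s - g m - (s - m) * g' m\<bar> \<le> c * (s - m)\<^sup>2"
proof -
  have seg: "closed_segment m s \<subseteq> S"
    by (rule closed_segment_subset[OF m s S])
  have "\<bar>(g s - s * g' m) - (g m - m * g' m)\<bar> \<le> (c * \<bar>s - m\<bar>) * \<bar>s - m\<bar>"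
  proof (rule has_real_derivative_bound)
    fix x assume x: "x \<in> closed_segment m s"
    then have "x \<in> S" using seg by blast
    show "((\<lambda>s. g s - s * g' m) has_real_derivative g' x - g' m) (at x within closed_segment m s)"
      using has_field_derivative_subset[OF g[OF \<open>x \<in> S\<close>] seg]
      by (auto intro!: derivative_eq_intros)
    have "\<bar>g' x - g' m\<bar> \<le> c * \<bar>x - m\<bar>"
      using field_differentiable_bound[OF S g' _ \<open>x \<in> S\<close> m] g'' by simp
    also have "\<dots> \<le> c * \<bar>s - m\<bar>"
      using dist_in_closed_segment[OF x] g''[OF m] by (intro mult_left_mono) (auto simp: dist_real_def)
    finally show "\<bar>g' x - g' m\<bar> \<le> c * \<bar>s - m\<bar>" .
  qed
  then show ?thesis by (simp add: power2_eq_square algebra_simps)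
qed

lemma midpoint_rule_bound:
  fixes G :: "real \<Rightarrow> real"
  assumes S: "convex S"
    and G: "\<And>x. x \<in> S \<Longrightarrow> (G has_real_derivative g x) (at x within S)"
    and g: "\<And>x. x \<in> S \<Longrightarrow> (g has_real_derivative g' x) (at x within S)"
    and g': "\<And>x. x \<in> S \<Longrightarrow> (g' has_real_derivative g'' x) (at x within S)"
    and g'': "\<And>x. x \<in> S \<Longrightarrow> \<bar>g'' x\<bar> \<le> c"
    and t: "t \<in> S" and th: "t + h \<in> S"
  shows "\<bar>G (t + h) - G t - h * g (t + h / 2)\<bar> \<le> c * \<bar>h\<bar> ^ 3"
proof -
  define m where "m = t + h / 2"
  have seg: "closed_segment t (t + h) \<subseteq> S"
    by (rule closed_segment_subset[OF t th S])
  have m: "m \<in> S"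
    using seg by (auto simp: m_def closed_segment_eq_real_ivl)
  text \<open>Subtracting the second-order Taylor polynomial of \<open>G\<close> at \<open>m\<close>, whose quadratic
    term has equal values at the endpoints.\<close>
  define R where "R s = G s - s * g m - (s - m)\<^sup>2 / 2 * g' m" for s
  have "\<bar>R (t + h) - R t\<bar> \<le> (c * h\<^sup>2) * \<bar>(t + h) - t\<bar>"
  proof (rule has_real_derivative_bound)
    fix x assume x: "x \<in> closed_segment t (t + h)"
    then have "x \<in> S" using seg by blast
    show "(R has_real_derivative g x - g m - (x - m) * g' m) (at x within closed_segment t (t + h))"
      unfolding R_def using has_field_derivative_subset[OF G[OF \<open>x \<in> S\<close>] seg]
      by (auto intro!: derivative_eq_intros)
    have "\<bar>g x - g m - (x - m) * g' m\<bar> \<le> c * (x - m)\<^sup>2"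
      by (rule taylor_linear_remainder_bound[OF S g g' g'' \<open>x \<in> S\<close> m])
    also have "\<dots> \<le> c * h\<^sup>2"
    proof (rule mult_left_mono)
      have "\<bar>x - m\<bar> \<le> \<bar>h\<bar>"
        using x by (auto simp: m_def closed_segment_eq_real_ivl split: if_splits)
      then show "(x - m)\<^sup>2 \<le> h\<^sup>2" by (simp add: abs_le_square_iff)
    qed (use g''[OF m] in auto)
    finally show "\<bar>g x - g m - (x - m) * g' m\<bar> \<le> c * h\<^sup>2" .
  qed
  moreover have "R (t + h) - R t = G (t + h) - G t - h * g m"
    by (simp add: R_def m_def power2_eq_square algebra_simps)
  ultimately show ?thesis
    by (simp add: m_def power3_eq_cube power2_eq_square abs_mult)
qed

section \<open>Trotter steps and product formulas\<close>

lemma step_s1_evolve: "step_s1 f1 f2 H1 H2 t h v = evolve H2 (f2 (t + h) * h) (evolve H1 (f1 (t + h) * h) v)"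
  by (simp add: step_s1_def evolve_def)

lemma step_g1_evolve:
  "step_g1 f1 f2 H1 H2 t h v = evolve H2 (integral {t..t+h} f2) (evolve H1 (integral {t..t+h} f1) v)"
  by (simp add: step_g1_def evolve_def)

lemma step_s2_evolve: "step_s2 f1 f2 H1 H2 t h v = evolve H1 (h / 2 * f1 (t + h / 2))
    (evolve H2 (h * f2 (t + h / 2)) (evolve H1 (h / 2 * f1 (t + h / 2)) v))"
  by (simp add: step_s2_def evolve_def)

lemma step_g2_evolve: "step_g2 f1 f2 H1 H2 t h v = evolve H1 (integral {t+h/2..t+h} f1)
    (evolve H2 (integral {t..t+h} f2) (evolve H1 (integral {t..t+h/2} f1) v))"
  by (simp add: step_g2_def evolve_def)

lemma steps_error_le_sum:
  fixes S :: "real \<Rightarrow> real \<Rightarrow> 'a :: real_normed_vector \<Rightarrow> 'a"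
  assumes iso: "\<And>k x y. k < L \<Longrightarrow> norm (S (real k * h) h x - S (real k * h) h y) = norm (x - y)"
  shows "norm (steps S L h (p 0) - p (real L * h))
    \<le> (\<Sum>k<L. norm (S (real k * h) h (p (real k * h)) - p (real (Suc k) * h)))"
  using iso
proof (induction L)
  case (Suc n)
  let ?S = "S (real n * h) h"
  have "norm (steps S (Suc n) h (p 0) - p (real (Suc n) * h))
      \<le> norm (?S (steps S n h (p 0)) - ?S (p (real n * h))) + norm (?S (p (real n * h)) - p (real (Suc n) * h))"
    using norm_triangle_ineq[of "?S (steps S n h (p 0)) - ?S (p (real n * h))"
        "?S (p (real n * h)) - p (real (Suc n) * h)"] by simp
  also have "\<dots> = norm (steps S n h (p 0) - p (real n * h)) + norm (?S (p (real n * h)) - p (real (Suc n) * h))"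
    using Suc.prems[of n] by simp
  also have "\<dots> \<le> (\<Sum>k<Suc n. norm (S (real k * h) h (p (real k * h)) - p (real (Suc k) * h)))"
    using Suc by simp
  finally show ?case .
qed simp

lemma steps_error_le:
  fixes S :: "real \<Rightarrow> real \<Rightarrow> 'a :: real_normed_vector \<Rightarrow> 'a"
  assumes T: "T > 0" and L: "L \<ge> 1" and q: "q \<ge> 1"
    and iso: "\<And>t h x y. norm (S t h x - S t h y) = norm (x - y)"
    and local_error: "\<And>t h. 0 \<le> t \<Longrightarrow> 0 \<le> h \<Longrightarrow> t + h \<le> T \<Longrightarrow> norm (S t h (p t) - p (t + h)) \<le> K * h ^ q * M"
  shows "norm (steps S L (T / real L) (p 0) - p T) \<le> K * (T ^ q / real L ^ (q - 1)) * M"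
proof -
  define h where "h = T / real L"
  have h: "h \<ge> 0" and Lh: "real L * h = T"
    using T L by (auto simp: h_def)
  have "norm (steps S L h (p 0) - p (real L * h))
      \<le> (\<Sum>k<L. norm (S (real k * h) h (p (real k * h)) - p (real (Suc k) * h)))"
    by (rule steps_error_le_sum) (rule iso)
  also have "\<dots> \<le> (\<Sum>k<L. K * h ^ q * M)"
  proof (rule sum_mono)
    fix k assume "k \<in> {..<L}"
    then have "real k * h + h \<le> T"
      using h Lh mult_right_mono[of "real (Suc k)" "real L" h] by (auto simp: algebra_simps)
    then show "norm (S (real k * h) h (p (real k * h)) - p (real (Suc k) * h)) \<le> K * h ^ q * M"
      using local_error[of "real k * h" h] h by (simp add: algebra_simps)
  qed
  also have "\<dots> = K * (T ^ q / real L ^ (q - 1)) * M"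
    using L q by (cases q) (auto simp: h_def power_divide field_simps)
  finally show ?thesis
    using Lh by (simp add: h_def)
qed

section \<open>The Trotter error bounds\<close>

text \<open>\<open>trotter_data\<close> fixes exactly the data on which the constants of the theorem may depend;
  \<open>trotter_instance\<close> adds \<open>H1\<close>, its factor \<open>D1\<close> and the solution \<open>psi\<close>.\<close>

locale trotter_data =
  fixes T :: real and f1 f2 f1' f2' f1'' f2'' :: "real \<Rightarrow> real"
    and H2 :: "complex ^ 'n::finite ^ 'n" and C1 C2 :: real
  assumes T_pos: "T > 0"
    and f1_deriv: "\<And>t. t \<in> {0..T} \<Longrightarrow> (f1 has_real_derivative f1' t) (at t within {0..T})"
    and f1'_deriv: "\<And>t. t \<in> {0..T} \<Longrightarrow> (f1' has_real_derivative f1'' t) (at t within {0..T})"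
    and f1''_cont: "continuous_on {0..T} f1''"
    and f2_deriv: "\<And>t. t \<in> {0..T} \<Longrightarrow> (f2 has_real_derivative f2' t) (at t within {0..T})"
    and f2'_deriv: "\<And>t. t \<in> {0..T} \<Longrightarrow> (f2' has_real_derivative f2'' t) (at t within {0..T})"
    and f2''_cont: "continuous_on {0..T} f2''"
    and herm2: "hermitian H2" and C1_nonneg: "C1 \<ge> 0" and C2_nonneg: "C2 \<ge> 0"
begin

abbreviation "a0 \<equiv> supnorm T f1"
abbreviation "a1 \<equiv> supnorm T f1'"
abbreviation "a2 \<equiv> supnorm T f1''"
abbreviation "b0 \<equiv> supnorm T f2"
abbreviation "b1 \<equiv> supnorm T f2'"
abbreviation "b2 \<equiv> supnorm T f2''"

lemma f1_cont: "continuous_on {0..T} f1" by (rule DERIV_continuous_on[OF f1_deriv])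
lemma f1'_cont: "continuous_on {0..T} f1'" by (rule DERIV_continuous_on[OF f1'_deriv])
lemma f2_cont: "continuous_on {0..T} f2" by (rule DERIV_continuous_on[OF f2_deriv])
lemma f2'_cont: "continuous_on {0..T} f2'" by (rule DERIV_continuous_on[OF f2'_deriv])

lemma abs_f1_le: "t \<in> {0..T} \<Longrightarrow> \<bar>f1 t\<bar> \<le> a0" by (rule abs_le_supnorm[OF f1_cont])
lemma abs_f1'_le: "t \<in> {0..T} \<Longrightarrow> \<bar>f1' t\<bar> \<le> a1" by (rule abs_le_supnorm[OF f1'_cont])
lemma abs_f1''_le: "t \<in> {0..T} \<Longrightarrow> \<bar>f1'' t\<bar> \<le> a2" by (rule abs_le_supnorm[OF f1''_cont])
lemma abs_f2_le: "t \<in> {0..T} \<Longrightarrow> \<bar>f2 t\<bar> \<le> b0" by (rule abs_le_supnorm[OF f2_cont])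
lemma abs_f2'_le: "t \<in> {0..T} \<Longrightarrow> \<bar>f2' t\<bar> \<le> b1" by (rule abs_le_supnorm[OF f2'_cont])
lemma abs_f2''_le: "t \<in> {0..T} \<Longrightarrow> \<bar>f2'' t\<bar> \<le> b2" by (rule abs_le_supnorm[OF f2''_cont])

lemma supnorm_nonneg: "0 \<le> a0" "0 \<le> a1" "0 \<le> a2" "0 \<le> b0" "0 \<le> b1" "0 \<le> b2"
  using abs_f1_le[of 0] abs_f1'_le[of 0] abs_f1''_le[of 0] abs_f2_le[of 0] abs_f2'_le[of 0]
    abs_f2''_le[of 0] T_pos
  by force+

definition F1 :: "real \<Rightarrow> real" where "F1 x = integral {0..x} f1"
definition F2 :: "real \<Rightarrow> real" where "F2 x = integral {0..x} f2"

lemma F1_deriv: "t \<in> {0..T} \<Longrightarrow> (F1 has_real_derivative f1 t) (at t within {0..T})"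
  unfolding F1_def by (rule integral_has_real_derivative[OF f1_cont])

lemma F2_deriv: "t \<in> {0..T} \<Longrightarrow> (F2 has_real_derivative f2 t) (at t within {0..T})"
  unfolding F2_def by (rule integral_has_real_derivative[OF f2_cont])

lemma integral_f1:
  assumes "0 \<le> a" "a \<le> b" "b \<le> T"
  shows "integral {a..b} f1 = F1 b - F1 a"
proof -
  have "f1 integrable_on {0..b}"
    by (intro integrable_continuous_real continuous_on_subset[OF f1_cont]) (use assms in auto)
  from Henstock_Kurzweil_Integration.integral_combine[OF assms(1,2) this] show ?thesis
    by (simp add: F1_def)
qed

lemma integral_f2:
  assumes "0 \<le> a" "a \<le> b" "b \<le> T"
  shows "integral {a..b} f2 = F2 b - F2 a"
proof -
  have "f2 integrable_on {0..b}"
    by (intro integrable_continuous_real continuous_on_subset[OF f2_cont]) (use assms in auto)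
  from Henstock_Kurzweil_Integration.integral_combine[OF assms(1,2) this] show ?thesis
    by (simp add: F2_def)
qed

lemma abs_F1_diff_le:
  assumes "x \<in> {0..T}" "y \<in> {0..T}"
  shows "\<bar>F1 x - F1 y\<bar> \<le> a0 * \<bar>x - y\<bar>"
  using field_differentiable_bound[OF convex_real_interval(5) F1_deriv _ assms] abs_f1_le by auto

lemma abs_F2_diff_le:
  assumes "x \<in> {0..T}" "y \<in> {0..T}"
  shows "\<bar>F2 x - F2 y\<bar> \<le> b0 * \<bar>x - y\<bar>"
  using field_differentiable_bound[OF convex_real_interval(5) F2_deriv _ assms] abs_f2_le by auto

lemma abs_f1_diff_le:
  assumes "x \<in> {0..T}" "y \<in> {0..T}"
  shows "\<bar>f1 x - f1 y\<bar> \<le> a1 * \<bar>x - y\<bar>"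
  using field_differentiable_bound[OF convex_real_interval(5) f1_deriv _ assms] abs_f1'_le by auto

lemma abs_f2_diff_le:
  assumes "x \<in> {0..T}" "y \<in> {0..T}"
  shows "\<bar>f2 x - f2 y\<bar> \<le> b1 * \<bar>x - y\<bar>"
  using field_differentiable_bound[OF convex_real_interval(5) f2_deriv _ assms] abs_f2'_le by auto

definition K_comm :: real where "K_comm = C1 * (3 + C1 * b0 * T) * b0"
definition K_s1 :: real where "K_s1 = a0 * K_comm + a1 + b1 * opnorm H2"
definition K_g1 :: real where "K_g1 = a0 * K_comm"

lemma K_comm_nonneg: "K_comm \<ge> 0"
  unfolding K_comm_def using C1_nonneg supnorm_nonneg T_pos by simp

lemma commutator_growth_le:
  assumes "0 \<le> N" "N \<le> M + r" "0 \<le> r" "0 \<le> M" "\<bar>y\<bar> \<le> b0 * h" "0 \<le> h" "h \<le> T"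
  shows "C1 * (N + r * (2 + C1 * \<bar>y\<bar>)) * \<bar>y\<bar> \<le> K_comm * h * (M + r)"
proof -
  have "\<bar>y\<bar> \<le> b0 * T"
    using assms supnorm_nonneg by (meson mult_left_mono order_trans)
  then have "2 + C1 * \<bar>y\<bar> \<le> 2 + C1 * b0 * T"
    using C1_nonneg by (simp add: mult.assoc mult_left_mono)
  then have "r * (2 + C1 * \<bar>y\<bar>) \<le> (M + r) * (2 + C1 * b0 * T)"
    using assms C1_nonneg supnorm_nonneg T_pos by (intro mult_mono) auto
  then have "N + r * (2 + C1 * \<bar>y\<bar>) \<le> (3 + C1 * b0 * T) * (M + r)"
    using assms by (simp add: algebra_simps)
  then have "C1 * (N + r * (2 + C1 * \<bar>y\<bar>)) * \<bar>y\<bar> \<le> C1 * ((3 + C1 * b0 * T) * (M + r)) * (b0 * h)"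
    using assms C1_nonneg supnorm_nonneg T_pos
    by (intro mult_mono mult_left_mono) (auto intro!: mult_nonneg_nonneg add_nonneg_nonneg)
  then show ?thesis by (simp add: K_comm_def ac_simps)
qed

definition K_phi :: real where
  "K_phi = b1 * (2 * C1) + b0 * (b0 * (2 * C1 * (opnorm H2 + 2 * C1)) + b0 * opnorm H2 * (2 * C1))"

definition K_g2 :: real where "K_g2 = a0 * K_phi + (a1 * b0 * (2 * C1) + b0 * C2 * a0\<^sup>2)"

lemma K_g2_nonneg: "K_g2 \<ge> 0"
  unfolding K_g2_def K_phi_def using supnorm_nonneg C1_nonneg C2_nonneg opnorm_nonneg[of H2]
  by (intro add_nonneg_nonneg mult_nonneg_nonneg) auto

definition K_s2 :: real where "K_s2 = K_g2 + a2 * (1 + K_comm * T) + K_comm * a1 + opnorm H2 * b2"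

lemma midpoint_phase_errors:
  assumes t: "0 \<le> t" "0 \<le> h" "t + h \<le> T"
  shows "\<bar>F1 (t + h) - F1 t - h * f1 (t + h / 2)\<bar> \<le> a2 * h ^ 3"
    and "\<bar>F1 (t + h / 2) - F1 t - h / 2 * f1 (t + h / 2)\<bar> \<le> a1 * h\<^sup>2"
    and "\<bar>F2 (t + h) - F2 t - h * f2 (t + h / 2)\<bar> \<le> b2 * h ^ 3"
proof -
  have tT: "t \<in> {0..T}" and thT: "t + h \<in> {0..T}" and mT: "t + h / 2 \<in> {0..T}"
    using t by auto
  show "\<bar>F1 (t + h) - F1 t - h * f1 (t + h / 2)\<bar> \<le> a2 * h ^ 3"
    using midpoint_rule_bound[OF convex_real_interval(5) F1_deriv f1_deriv f1'_deriv abs_f1''_le tT thT] t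
    by simp
  show "\<bar>F2 (t + h) - F2 t - h * f2 (t + h / 2)\<bar> \<le> b2 * h ^ 3"
    using midpoint_rule_bound[OF convex_real_interval(5) F2_deriv f2_deriv f2'_deriv abs_f2''_le tT thT] t
    by simp
  have "\<bar>F1 t - F1 (t + h / 2) - (t - (t + h / 2)) * f1 (t + h / 2)\<bar> \<le> a1 * (t - (t + h / 2))\<^sup>2"
    by (rule taylor_linear_remainder_bound[OF convex_real_interval(5) F1_deriv f1_deriv abs_f1'_le tT mT])
  also have "\<dots> \<le> a1 * h\<^sup>2"
    using supnorm_nonneg t by (intro mult_left_mono) (auto simp: power2_eq_square)
  finally show "\<bar>F1 (t + h / 2) - F1 t - h / 2 * f1 (t + h / 2)\<bar> \<le> a1 * h\<^sup>2"
    by (simp add: abs_minus_commute algebra_simps)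
qed

end

locale trotter_instance =
  trotter_data T f1 f2 f1' f2' f1'' f2'' H2 C1 C2 + commutator_bounds H1 H2 D1 C1 C2
  for T f1 f2 f1' f2' f1'' f2'' and H2 H1 D1 :: "complex ^ 'n::finite ^ 'n" and C1 C2 +
  fixes psi :: "real \<Rightarrow> complex ^ 'n"
  assumes schroedinger: "\<And>t. t \<in> {0..T} \<Longrightarrow>
      (psi has_vector_derivative (- \<i>) *s ((f1 t *\<^sub>R H1 + f2 t *\<^sub>R H2) *v psi t)) (at t within {0..T})"
begin

lemma psi_deriv: "t \<in> {0..T} \<Longrightarrow>
    (psi has_vector_derivative - J (f1 t *\<^sub>R (H1 *v psi t) + f2 t *\<^sub>R (H2 *v psi t))) (at t within {0..T})"
  using schroedinger
  by (simp add: J_def vector_smult_lneg matrix_vector_mult_add_rdistrib matrix_vector_mult_scaleR_left)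

lemma psi_cont: "continuous_on {0..T} psi"
  unfolding continuous_on_eq_continuous_within
  using schroedinger has_vector_derivative_continuous by blast

lemma H1_psi_cont: "continuous_on {0..T} (\<lambda>t. H1 *v psi t)"
  by (rule bounded_linear.continuous_on[OF matrix_vector_mul_bounded_linear psi_cont])

lemma norm_psi: "t \<in> {0..T} \<Longrightarrow> norm (psi t) = norm (psi 0)"
proof (rule hermitian_flow_norm_eq[where B = "\<lambda>t. f1 t *\<^sub>R H1 + f2 t *\<^sub>R H2"])
  fix x assume t: "t \<in> {0..T}" and x: "x \<in> closed_segment 0 t"
  then have sub: "closed_segment 0 t \<subseteq> {0..T}" and "x \<in> {0..T}"
    by (auto simp: closed_segment_eq_real_ivl)
  show "(psi has_vector_derivative - J ((f1 x *\<^sub>R H1 + f2 x *\<^sub>R H2) *v psi x)) (at x within closed_segment 0 t)"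
    using has_vector_derivative_within_subset[OF psi_deriv[OF \<open>x \<in> {0..T}\<close>] sub]
    by (simp add: matrix_vector_mult_add_rdistrib matrix_vector_mult_scaleR_left)
  show "hermitian (f1 x *\<^sub>R H1 + f2 x *\<^sub>R H2)"
    by (rule hermitian_scaleR_add[OF herm1 herm2])
qed

definition M_H1 :: real where "M_H1 = (SUP t\<in>{0..T}. norm (H1 *v psi t))"
definition M_sqrt :: real where "M_sqrt = (SUP t\<in>{0..T}. sqrt (norm (psi 0) * norm (H1 *v psi t)))"

lemma norm_H1_psi_le: "t \<in> {0..T} \<Longrightarrow> norm (H1 *v psi t) \<le> M_H1"
  unfolding M_H1_def
  by (intro cSUP_upper bounded_imp_bdd_above compact_imp_bounded compact_continuous_image
      continuous_intros H1_psi_cont compact_Icc) auto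

lemma sqrt_H1_psi_le: "t \<in> {0..T} \<Longrightarrow> sqrt (norm (psi 0) * norm (H1 *v psi t)) \<le> M_sqrt"
  unfolding M_sqrt_def
  by (intro cSUP_upper bounded_imp_bdd_above compact_imp_bounded compact_continuous_image
      continuous_intros H1_psi_cont compact_Icc) auto

lemma M_H1_nonneg: "M_H1 \<ge> 0"
  using norm_H1_psi_le[of 0] T_pos by (meson atLeastAtMost_iff norm_ge_zero order.trans less_imp_le order_refl)

lemma M_sqrt_nonneg: "M_sqrt \<ge> 0"
  using sqrt_H1_psi_le[of 0] T_pos by (meson atLeastAtMost_iff real_sqrt_ge_zero mult_nonneg_nonneg
      norm_ge_zero order.trans less_imp_le order_refl)

lemma norm_D1_psi_le: "t \<in> {0..T} \<Longrightarrow> norm (D1 *v psi t) \<le> M_H1 + norm (psi 0)"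
  using norm_D1_le_mean[of "psi t"] norm_H1_psi_le[of t] norm_psi[of t] M_H1_nonneg
    norm_ge_zero[of "psi 0"] by linarith

lemma norm_D1_psi_le_sqrt: "t \<in> {0..T} \<Longrightarrow> norm (D1 *v psi t) \<le> M_sqrt + norm (psi 0)"
  using norm_D1_le_sqrt[of "psi t"] sqrt_H1_psi_le[of t] norm_psi[of t] by (simp add: add_increasing2)

text \<open>The interaction picture of a two-factor splitting with phases \<open>a\<close>, \<open>b\<close>: its derivative
  only involves \<open>H1\<close> through the commutator of \<open>H1\<close> with \<open>exp(i b H2)\<close> and through the phase
  errors \<open>a' - f1\<close>, \<open>b' - f2\<close>.\<close>

lemma interaction_picture_has_vector_derivative:
  assumes s: "s \<in> {0..T}" and S: "S \<subseteq> {0..T}"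
    and da: "(a has_real_derivative a') (at s within S)"
    and db: "(b has_real_derivative b') (at s within S)"
  shows "((\<lambda>s. evolve H1 (- a s) (evolve H2 (- b s) (psi s))) has_vector_derivative
      evolve H1 (- a s) (J (a' *\<^sub>R (H1 *v evolve H2 (- b s) (psi s) - evolve H2 (- b s) (H1 *v psi s))
        + (a' - f1 s) *\<^sub>R evolve H2 (- b s) (H1 *v psi s)
        + (b' - f2 s) *\<^sub>R evolve H2 (- b s) (H2 *v psi s)))) (at s within S)"
proof -
  have "((\<lambda>s. evolve H2 (- b s) (psi s)) has_vector_derivative
      evolve H2 (- b s) (- J (f1 s *\<^sub>R (H1 *v psi s) + f2 s *\<^sub>R (H2 *v psi s)))
      - (- b') *\<^sub>R J (H2 *v evolve H2 (- b s) (psi s))) (at s within S)"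
    by (rule evolve_has_vector_derivative_chain[OF herm2 DERIV_minus[OF db]
          has_vector_derivative_within_subset[OF psi_deriv[OF s] S]])
  from evolve_has_vector_derivative_chain[OF herm1 DERIV_minus[OF da] this]
  show ?thesis
    by (simp add: evolve_commute[OF herm1] evolve_commute[OF herm2] evolve_H1_simps evolve_H2_simps J_simps
        algebra_simps)
qed

lemma norm_interaction_picture_derivative_le:
  assumes s: "s \<in> {0..T}"
  shows "norm (a' *\<^sub>R (H1 *v evolve H2 (- b) (psi s) - evolve H2 (- b) (H1 *v psi s))
      + (a' - f1 s) *\<^sub>R evolve H2 (- b) (H1 *v psi s) + (b' - f2 s) *\<^sub>R evolve H2 (- b) (H2 *v psi s))
    \<le> \<bar>a'\<bar> * (C1 * (norm (D1 *v psi s) + norm (psi 0) * (2 + C1 * \<bar>b\<bar>)) * \<bar>b\<bar>)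
      + \<bar>a' - f1 s\<bar> * norm (H1 *v psi s) + \<bar>b' - f2 s\<bar> * (opnorm H2 * norm (psi 0))"
proof -
  have "norm (H1 *v evolve H2 (- b) (psi s) - evolve H2 (- b) (H1 *v psi s))
      = norm (evolve H2 b (H1 *v evolve H2 (- b) (psi s) - evolve H2 (- b) (H1 *v psi s)))"
    by (rule evolve_norm[OF herm2, symmetric])
  also have "\<dots> = norm (evolve H2 (- (- b)) (H1 *v evolve H2 (- b) (psi s)) - H1 *v psi s)"
    by (simp add: evolve_diff[OF herm2] evolve_inverse'[OF herm2])
  finally have "norm (H1 *v evolve H2 (- b) (psi s) - evolve H2 (- b) (H1 *v psi s))
      \<le> C1 * (norm (D1 *v psi s) + norm (psi 0) * (2 + C1 * \<bar>b\<bar>)) * \<bar>b\<bar>"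
    using norm_evolve_H2_conj_H1_diff_le[of "- b" "psi s"] norm_psi[OF s] by simp
  then show ?thesis
    using norm_matrix_vector_le_opnorm[of H2 "psi s"] norm_psi[OF s]
    by (intro order_trans[OF norm_triangle_ineq] order_trans[OF add_mono[OF norm_triangle_ineq order_refl]]
        add_mono) (simp_all add: evolve_H2_simps mult_left_mono)
qed

lemma local_error_first_order:
  assumes t: "0 \<le> t" "0 \<le> h" "t + h \<le> T"
    and da: "\<And>s. s \<in> {t..t+h} \<Longrightarrow> (a has_real_derivative a' s) (at s within {t..t+h})"
    and db: "\<And>s. s \<in> {t..t+h} \<Longrightarrow> (b has_real_derivative b' s) (at s within {t..t+h})"
    and a0: "a t = 0" and b0: "b t = 0"
    and bound: "\<And>s. s \<in> {t..t+h} \<Longrightarrow>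
      \<bar>a' s\<bar> * (C1 * (norm (D1 *v psi s) + norm (psi 0) * (2 + C1 * \<bar>b s\<bar>)) * \<bar>b s\<bar>)
        + \<bar>a' s - f1 s\<bar> * norm (H1 *v psi s) + \<bar>b' s - f2 s\<bar> * (opnorm H2 * norm (psi 0)) \<le> K"
  shows "norm (evolve H2 (b (t + h)) (evolve H1 (a (t + h)) (psi t)) - psi (t + h)) \<le> K * h"
proof -
  define X where "X s = evolve H1 (- a s) (evolve H2 (- b s) (psi s))" for s
  define Z where "Z s = a' s *\<^sub>R (H1 *v evolve H2 (- b s) (psi s) - evolve H2 (- b s) (H1 *v psi s))
      + (a' s - f1 s) *\<^sub>R evolve H2 (- b s) (H1 *v psi s) + (b' s - f2 s) *\<^sub>R evolve H2 (- b s) (H2 *v psi s)"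
    for s
  have seg: "closed_segment t (t + h) = {t..t+h}" and sub: "{t..t+h} \<subseteq> {0..T}"
    using t by (auto simp: closed_segment_eq_real_ivl)
  have X_bound: "norm (X (t + h) - X t) \<le> K * \<bar>(t + h) - t\<bar>"
  proof (rule has_vector_derivative_bound, unfold seg)
    fix s assume s: "s \<in> {t..t+h}"
    then have sT: "s \<in> {0..T}" using sub by blast
    show "(X has_vector_derivative evolve H1 (- a s) (J (Z s))) (at s within {t..t+h})"
      unfolding X_def Z_def
      by (rule interaction_picture_has_vector_derivative[OF sT sub da[OF s] db[OF s]])
    have "norm (evolve H1 (- a s) (J (Z s))) = norm (Z s)"
      by (simp only: evolve_norm[OF herm1] norm_J)
    then show "norm (evolve H1 (- a s) (J (Z s))) \<le> K"
      using norm_interaction_picture_derivative_le[OF sT, of "a' s" "b s" "b' s"] bound[OF s]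
      unfolding Z_def by linarith
  qed
  have "norm (evolve H2 (b (t + h)) (evolve H1 (a (t + h)) (psi t)) - psi (t + h))
      = norm (evolve H1 (- a (t + h)) (evolve H2 (- b (t + h))
          (evolve H2 (b (t + h)) (evolve H1 (a (t + h)) (psi t)) - psi (t + h))))"
    by (simp only: evolve_norm[OF herm1] evolve_norm[OF herm2])
  also have "\<dots> = norm (X t - X (t + h))"
    by (simp add: X_def a0 b0 evolve_diff[OF herm1] evolve_diff[OF herm2] evolve_inverse[OF herm1]
        evolve_inverse[OF herm2])
  finally show ?thesis
    using X_bound t by (simp add: norm_minus_commute)
qed

lemma local_error_s1:
  assumes t: "0 \<le> t" "0 \<le> h" "t + h \<le> T"
  shows "norm (step_s1 f1 f2 H1 H2 t h (psi t) - psi (t + h)) \<le> K_s1 * h\<^sup>2 * (M_H1 + norm (psi 0))"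
proof -
  let ?M = "M_H1 + norm (psi 0)"
  have "norm (evolve H2 ((\<lambda>s. f2 (t + h) * (s - t)) (t + h)) (evolve H1 ((\<lambda>s. f1 (t + h) * (s - t)) (t + h))
      (psi t)) - psi (t + h)) \<le> (K_s1 * h * ?M) * h"
  proof (rule local_error_first_order[OF t, where a = "\<lambda>s. f1 (t + h) * (s - t)" and a' = "\<lambda>_. f1 (t + h)"
        and b = "\<lambda>s. f2 (t + h) * (s - t)" and b' = "\<lambda>_. f2 (t + h)"])
    fix s assume s: "s \<in> {t..t+h}"
    then have sT: "s \<in> {0..T}" and thT: "t + h \<in> {0..T}" and hs: "\<bar>s - t\<bar> \<le> h" "\<bar>t + h - s\<bar> \<le> h"
      using t by auto
    have "\<bar>f2 (t + h) * (s - t)\<bar> \<le> b0 * h"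
      unfolding abs_mult using abs_f2_le[OF thT] hs by (intro mult_mono) auto
    then have comm: "C1 * (norm (D1 *v psi s) + norm (psi 0) * (2 + C1 * \<bar>f2 (t + h) * (s - t)\<bar>))
        * \<bar>f2 (t + h) * (s - t)\<bar> \<le> K_comm * h * ?M"
      using norm_D1_psi_le[OF sT] M_H1_nonneg t by (intro commutator_growth_le) auto
    have "\<bar>f1 (t + h)\<bar> * (C1 * (norm (D1 *v psi s) + norm (psi 0) * (2 + C1 * \<bar>f2 (t + h) * (s - t)\<bar>))
        * \<bar>f2 (t + h) * (s - t)\<bar>) \<le> a0 * (K_comm * h * ?M)"
      by (rule mult_mono[OF abs_f1_le[OF thT] comm])
        (use supnorm_nonneg C1_nonneg in \<open>auto intro!: mult_nonneg_nonneg add_nonneg_nonneg\<close>)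
    moreover have "\<bar>f1 (t + h) - f1 s\<bar> * norm (H1 *v psi s) \<le> (a1 * h) * M_H1"
      using abs_f1_diff_le[OF thT sT] mult_left_mono[OF hs(2), of a1] supnorm_nonneg norm_H1_psi_le[OF sT]
      by (intro mult_mono) auto
    moreover have "\<bar>f2 (t + h) - f2 s\<bar> * (opnorm H2 * norm (psi 0)) \<le> (b1 * h) * (opnorm H2 * norm (psi 0))"
      using abs_f2_diff_le[OF thT sT] mult_left_mono[OF hs(2), of b1] supnorm_nonneg opnorm_nonneg[of H2]
      by (intro mult_right_mono) auto
    moreover have "(a1 * h) * M_H1 + (b1 * h) * (opnorm H2 * norm (psi 0)) \<le> (a1 + b1 * opnorm H2) * h * ?M"
      using supnorm_nonneg opnorm_nonneg[of H2] M_H1_nonneg t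
      by (simp add: algebra_simps add_mono mult_nonneg_nonneg)
    ultimately show "\<bar>f1 (t + h)\<bar> * (C1 * (norm (D1 *v psi s) + norm (psi 0) * (2 + C1 * \<bar>f2 (t + h) * (s - t)\<bar>))
        * \<bar>f2 (t + h) * (s - t)\<bar>) + \<bar>f1 (t + h) - f1 s\<bar> * norm (H1 *v psi s)
        + \<bar>f2 (t + h) - f2 s\<bar> * (opnorm H2 * norm (psi 0)) \<le> K_s1 * h * ?M"
      by (simp add: K_s1_def algebra_simps)
  qed (auto intro!: derivative_eq_intros)
  then show ?thesis
    by (simp add: step_s1_evolve power2_eq_square ac_simps)
qed

lemma local_error_g1:
  assumes t: "0 \<le> t" "0 \<le> h" "t + h \<le> T"
  shows "norm (step_g1 f1 f2 H1 H2 t h (psi t) - psi (t + h)) \<le> K_g1 * h\<^sup>2 * (M_sqrt + norm (psi 0))"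
proof -
  let ?M = "M_sqrt + norm (psi 0)"
  have sub: "{t..t+h} \<subseteq> {0..T}" using t by auto
  have "norm (evolve H2 ((\<lambda>s. F2 s - F2 t) (t + h)) (evolve H1 ((\<lambda>s. F1 s - F1 t) (t + h)) (psi t))
      - psi (t + h)) \<le> (K_g1 * h * ?M) * h"
  proof (rule local_error_first_order[OF t, where a = "\<lambda>s. F1 s - F1 t" and a' = f1
        and b = "\<lambda>s. F2 s - F2 t" and b' = f2])
    fix s assume s: "s \<in> {t..t+h}"
    then have sT: "s \<in> {0..T}" and tT: "t \<in> {0..T}" and hs: "\<bar>s - t\<bar> \<le> h"
      using t by auto
    show "((\<lambda>s. F1 s - F1 t) has_real_derivative f1 s) (at s within {t..t+h})"
      using has_field_derivative_subset[OF F1_deriv[OF sT] sub] by (auto intro!: derivative_eq_intros)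
    show "((\<lambda>s. F2 s - F2 t) has_real_derivative f2 s) (at s within {t..t+h})"
      using has_field_derivative_subset[OF F2_deriv[OF sT] sub] by (auto intro!: derivative_eq_intros)
    have "\<bar>F2 s - F2 t\<bar> \<le> b0 * h"
      using abs_F2_diff_le[OF sT tT] mult_left_mono[OF hs, of b0] supnorm_nonneg by linarith
    then have comm: "C1 * (norm (D1 *v psi s) + norm (psi 0) * (2 + C1 * \<bar>F2 s - F2 t\<bar>))
        * \<bar>F2 s - F2 t\<bar> \<le> K_comm * h * ?M"
      using norm_D1_psi_le_sqrt[OF sT] M_sqrt_nonneg t by (intro commutator_growth_le) auto
    have "\<bar>f1 s\<bar> * (C1 * (norm (D1 *v psi s) + norm (psi 0) * (2 + C1 * \<bar>F2 s - F2 t\<bar>))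
        * \<bar>F2 s - F2 t\<bar>) \<le> a0 * (K_comm * h * ?M)"
      by (rule mult_mono[OF abs_f1_le[OF sT] comm])
        (use supnorm_nonneg C1_nonneg in \<open>auto intro!: mult_nonneg_nonneg add_nonneg_nonneg\<close>)
    then show "\<bar>f1 s\<bar> * (C1 * (norm (D1 *v psi s) + norm (psi 0) * (2 + C1 * \<bar>F2 s - F2 t\<bar>))
        * \<bar>F2 s - F2 t\<bar>) + \<bar>f1 s - f1 s\<bar> * norm (H1 *v psi s) + \<bar>f2 s - f2 s\<bar> * (opnorm H2 * norm (psi 0))
        \<le> K_g1 * h * ?M"
      by (simp add: K_g1_def ac_simps)
  qed auto
  moreover have "integral {t..t+h} f1 = F1 (t + h) - F1 t" "integral {t..t+h} f2 = F2 (t + h) - F2 t"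
    using t by (auto intro: integral_f1 integral_f2)
  ultimately show ?thesis
    by (simp add: step_g1_evolve power2_eq_square ac_simps)
qed

text \<open>Interaction pictures for a symmetric step with midpoint \<open>m\<close>: \<open>zeta m\<close> undoes the
  \<open>H1\<close>-evolution relative to \<open>m\<close>, and \<open>eta t m\<close> in addition the \<open>H2\<close>-evolution relative to \<open>t\<close>.
  Up to \<open>O((s - m)\<^sup>2)\<close> the derivative \<open>eta' t m s\<close> equals \<open>(s - m) f1(m) phi t m s\<close>, whose
  integral over an interval centred at \<open>m\<close> is of third order because \<open>phi\<close> is Lipschitz.\<close>

definition "zeta m s = evolve H1 (F1 m - F1 s) (psi s)"
definition "zeta' m s = - (f2 s *\<^sub>R J (evolve H1 (F1 m - F1 s) (H2 *v psi s)))"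
definition "eta t m s = evolve H2 (F2 t - F2 s) (zeta m s)"
definition "eta' t m s =
  f2 s *\<^sub>R J (evolve H2 (F2 t - F2 s) (H2 *v zeta m s - evolve H1 (F1 m - F1 s) (H2 *v psi s)))"
definition "phi t m s = f2 s *\<^sub>R evolve H2 (F2 t - F2 s) (comm H1 H2 *v zeta m s)"
definition "phi' t m s = f2' s *\<^sub>R evolve H2 (F2 t - F2 s) (comm H1 H2 *v zeta m s)
  + f2 s *\<^sub>R (evolve H2 (F2 t - F2 s) (comm H1 H2 *v zeta' m s)
  + f2 s *\<^sub>R J (H2 *v evolve H2 (F2 t - F2 s) (comm H1 H2 *v zeta m s)))"

lemma zeta_has_vector_derivative:
  assumes s: "s \<in> {0..T}"
  shows "(zeta m has_vector_derivative zeta' m s) (at s within {0..T})"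
proof -
  have "((\<lambda>s. F1 m - F1 s) has_real_derivative - f1 s) (at s within {0..T})"
    using F1_deriv[OF s] by (auto intro!: derivative_eq_intros)
  from evolve_has_vector_derivative_chain[OF herm1 this psi_deriv[OF s]] show ?thesis
    unfolding zeta_def zeta'_def
    by (simp add: evolve_H1_simps evolve_commute[OF herm1] J_simps algebra_simps)
qed

lemma F2_diff_has_real_derivative:
  "s \<in> {0..T} \<Longrightarrow> ((\<lambda>s. F2 t - F2 s) has_real_derivative - f2 s) (at s within {0..T})"
  using F2_deriv by (auto intro!: derivative_eq_intros)

lemma eta_has_vector_derivative:
  assumes s: "s \<in> {0..T}"
  shows "(eta t m has_vector_derivative eta' t m s) (at s within {0..T})"
  using evolve_has_vector_derivative_chain[OF herm2 F2_diff_has_real_derivative[OF s]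
      zeta_has_vector_derivative[OF s]]
  unfolding eta_def eta'_def zeta'_def
  by (simp add: evolve_H2_simps evolve_commute[OF herm2] J_simps algebra_simps)

lemma phi_has_vector_derivative:
  assumes s: "s \<in> {0..T}"
  shows "(phi t m has_vector_derivative phi' t m s) (at s within {0..T})"
proof -
  have "((\<lambda>s. comm H1 H2 *v zeta m s) has_vector_derivative comm H1 H2 *v zeta' m s) (at s within {0..T})"
    by (rule bounded_linear.has_vector_derivative[OF matrix_vector_mul_bounded_linear
          zeta_has_vector_derivative[OF s]])
  from evolve_has_vector_derivative_chain[OF herm2 F2_diff_has_real_derivative[OF s] this]
  have "((\<lambda>s. evolve H2 (F2 t - F2 s) (comm H1 H2 *v zeta m s)) has_vector_derivative
      evolve H2 (F2 t - F2 s) (comm H1 H2 *v zeta' m s)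
      + f2 s *\<^sub>R J (H2 *v evolve H2 (F2 t - F2 s) (comm H1 H2 *v zeta m s))) (at s within {0..T})"
    by simp
  from has_vector_derivative_scaleR[OF f2_deriv[OF s] this] show ?thesis
    unfolding phi_def phi'_def by (simp add: algebra_simps)
qed

lemma norm_zeta: "s \<in> {0..T} \<Longrightarrow> norm (zeta m s) = norm (psi 0)"
  unfolding zeta_def evolve_H1_simps by (rule norm_psi)

lemma norm_H1_zeta: "s \<in> {0..T} \<Longrightarrow> norm (H1 *v zeta m s) \<le> M_H1"
  by (simp add: zeta_def norm_H1_evolve_H1 norm_H1_psi_le)

lemma norm_comm_zeta: "s \<in> {0..T} \<Longrightarrow> norm (comm H1 H2 *v zeta m s) \<le> 2 * C1 * (M_H1 + norm (psi 0))"
  using norm_comm_le[of "zeta m s"] norm_H1_zeta[of s m] norm_zeta[of s m] C1_nonneg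
  by (smt (verit, best) mult_left_mono)

lemma norm_comm_zeta':
  assumes s: "s \<in> {0..T}"
  shows "norm (comm H1 H2 *v zeta' m s) \<le> b0 * (2 * C1 * (opnorm H2 + 2 * C1) * (M_H1 + norm (psi 0)))"
proof -
  define w where "w = evolve H1 (F1 m - F1 s) (H2 *v psi s)"
  have norm_w: "norm w \<le> opnorm H2 * norm (psi 0)"
    using norm_matrix_vector_le_opnorm[of H2 "psi s"] by (simp add: w_def evolve_H1_simps norm_psi[OF s])
  have "norm (H1 *v w) = norm (H2 *v (H1 *v psi s) + comm H1 H2 *v psi s)"
    by (simp add: w_def norm_H1_evolve_H1 comm_matrix_vector_mult)
  also have "\<dots> \<le> opnorm H2 * M_H1 + 2 * C1 * (M_H1 + norm (psi 0))"
    using norm_matrix_vector_le_opnorm[of H2 "H1 *v psi s"] norm_comm_le[of "psi s"]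
      mult_left_mono[OF norm_H1_psi_le[OF s] opnorm_nonneg[of H2]]
      mult_left_mono[OF add_mono[OF norm_H1_psi_le[OF s] eq_refl[OF norm_psi[OF s]]], of "2 * C1"] C1_nonneg
    by (intro order_trans[OF norm_triangle_ineq] add_mono) auto
  finally have "norm (comm H1 H2 *v w) \<le> 2 * C1 * ((opnorm H2 * M_H1 + 2 * C1 * (M_H1 + norm (psi 0)))
      + opnorm H2 * norm (psi 0))"
    using norm_comm_le[of w] norm_w C1_nonneg by (smt (verit, best) mult_left_mono)
  also have "\<dots> = 2 * C1 * (opnorm H2 + 2 * C1) * (M_H1 + norm (psi 0))"
    by (simp add: algebra_simps)
  finally have "norm (comm H1 H2 *v w) \<le> 2 * C1 * (opnorm H2 + 2 * C1) * (M_H1 + norm (psi 0))" .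
  moreover have "norm (comm H1 H2 *v zeta' m s) = \<bar>f2 s\<bar> * norm (comm H1 H2 *v w)"
    by (simp add: zeta'_def w_def matrix_vector_mult_uminus matrix_vector_mult_scaleR_right
        matrix_vector_mult_J norm_J)
  ultimately show ?thesis
    using abs_f2_le[OF s] by (simp add: mult_mono)
qed

lemma norm_phi: "s \<in> {0..T} \<Longrightarrow> norm (phi t m s) \<le> b0 * (2 * C1 * (M_H1 + norm (psi 0)))"
  using abs_f2_le[of s] norm_comm_zeta[of s m] by (simp add: phi_def evolve_H2_simps mult_mono)

lemma norm_phi': "s \<in> {0..T} \<Longrightarrow> norm (phi' t m s) \<le> K_phi * (M_H1 + norm (psi 0))"
proof -
  assume s: "s \<in> {0..T}"
  define X where "X = norm (comm H1 H2 *v zeta m s)"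
  define Y where "Y = norm (comm H1 H2 *v zeta' m s)"
  have X: "X \<le> 2 * C1 * (M_H1 + norm (psi 0))" "X \<ge> 0"
    using norm_comm_zeta[OF s] by (auto simp: X_def)
  have Y: "Y \<le> b0 * (2 * C1 * (opnorm H2 + 2 * C1) * (M_H1 + norm (psi 0)))" "Y \<ge> 0"
    using norm_comm_zeta'[OF s] by (auto simp: Y_def)
  have "norm (J (H2 *v evolve H2 (F2 t - F2 s) (comm H1 H2 *v zeta m s))) \<le> opnorm H2 * X"
    using norm_matrix_vector_le_opnorm[of H2 "evolve H2 (F2 t - F2 s) (comm H1 H2 *v zeta m s)"]
    by (simp add: norm_J X_def evolve_H2_simps)
  then have "norm (phi' t m s) \<le> \<bar>f2' s\<bar> * X + \<bar>f2 s\<bar> * (Y + \<bar>f2 s\<bar> * (opnorm H2 * X))"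
    unfolding phi'_def X_def Y_def
    by (intro order_trans[OF norm_triangle_ineq] add_mono)
      (auto simp: evolve_H2_simps intro!: mult_left_mono order_trans[OF norm_triangle_ineq])
  also have "\<dots> \<le> b1 * (2 * C1 * (M_H1 + norm (psi 0)))
      + b0 * (b0 * (2 * C1 * (opnorm H2 + 2 * C1) * (M_H1 + norm (psi 0)))
      + b0 * (opnorm H2 * (2 * C1 * (M_H1 + norm (psi 0)))))"
    using abs_f2'_le[OF s] abs_f2_le[OF s] X Y opnorm_nonneg[of H2] supnorm_nonneg
    by (intro add_mono mult_mono mult_left_mono) (auto intro!: mult_nonneg_nonneg add_nonneg_nonneg)
  also have "\<dots> = K_phi * (M_H1 + norm (psi 0))"
    by (simp add: K_phi_def algebra_simps)
  finally show ?thesis .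
qed

lemma norm_phi_diff_le:
  assumes x: "x \<in> {0..T}" and y: "y \<in> {0..T}"
  shows "norm (phi t m y - phi t m x) \<le> K_phi * (M_H1 + norm (psi 0)) * \<bar>y - x\<bar>"
proof (rule has_vector_derivative_bound)
  have sub: "closed_segment x y \<subseteq> {0..T}"
    by (rule closed_segment_subset[OF x y convex_real_interval(5)])
  fix s assume "s \<in> closed_segment x y"
  with sub have s: "s \<in> {0..T}" by blast
  show "(phi t m has_vector_derivative phi' t m s) (at s within closed_segment x y)"
    by (rule has_vector_derivative_within_subset[OF phi_has_vector_derivative[OF s] sub])
  show "norm (phi' t m s) \<le> K_phi * (M_H1 + norm (psi 0))"
    by (rule norm_phi'[OF s])
qed

lemma F1_taylor_bound:
  "s \<in> {0..T} \<Longrightarrow> m \<in> {0..T} \<Longrightarrow> \<bar>F1 s - F1 m - (s - m) * f1 m\<bar> \<le> a1 * (s - m)\<^sup>2"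
  by (rule taylor_linear_remainder_bound[OF convex_real_interval(5) F1_deriv f1_deriv abs_f1'_le])

lemma norm_H2_conj_remainder_zeta_le:
  assumes s: "s \<in> {0..T}" and m: "m \<in> {0..T}"
  shows "norm (evolve H1 (F1 m - F1 s) (H2 *v evolve H1 (- (F1 m - F1 s)) (zeta m s)) - H2 *v zeta m s
      + (F1 m - F1 s) *\<^sub>R J (comm H1 H2 *v zeta m s))
    \<le> C2 * (M_H1 + norm (psi 0)) * (a0\<^sup>2 * (s - m)\<^sup>2)"
proof -
  have "\<bar>F1 m - F1 s\<bar> \<le> a0 * \<bar>s - m\<bar>"
    using abs_F1_diff_le[OF m s] by (simp add: abs_minus_commute)
  then have "(F1 m - F1 s)\<^sup>2 \<le> (a0 * \<bar>s - m\<bar>)\<^sup>2"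
    using abs_le_square_iff[of "F1 m - F1 s" "a0 * \<bar>s - m\<bar>"] supnorm_nonneg by (simp add: abs_mult)
  then have \<theta>: "(F1 m - F1 s)\<^sup>2 \<le> a0\<^sup>2 * (s - m)\<^sup>2"
    by (simp add: power_mult_distrib)
  have "C2 * (norm (H1 *v zeta m s) + norm (zeta m s)) \<le> C2 * (M_H1 + norm (psi 0))"
    using norm_H1_zeta[OF s] norm_zeta[OF s] C2_nonneg by (intro mult_left_mono) auto
  then have "C2 * (norm (H1 *v zeta m s) + norm (zeta m s)) * (F1 m - F1 s)\<^sup>2
      \<le> C2 * (M_H1 + norm (psi 0)) * (a0\<^sup>2 * (s - m)\<^sup>2)"
    by (rule mult_mono[OF _ \<theta>])
      (use C2_nonneg M_H1_nonneg in \<open>auto intro!: mult_nonneg_nonneg add_nonneg_nonneg\<close>)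
  with norm_evolve_H1_conj_H2_expansion_le show ?thesis
    by (rule order_trans)
qed

lemma norm_eta'_expansion_le:
  assumes s: "s \<in> {0..T}" and m: "m \<in> {0..T}"
  shows "norm (eta' t m s - ((s - m) * f1 m) *\<^sub>R phi t m s)
    \<le> (a1 * b0 * (2 * C1) + b0 * C2 * a0\<^sup>2) * (M_H1 + norm (psi 0)) * (s - m)\<^sup>2"
proof -
  define \<theta> where "\<theta> = F1 m - F1 s"
  define z where "z = zeta m s"
  define E where "E = evolve H2 (F2 t - F2 s)"
  define R where "R = evolve H1 \<theta> (H2 *v evolve H1 (- \<theta>) z) - H2 *v z + \<theta> *\<^sub>R J (comm H1 H2 *v z)"
  have "evolve H1 (- \<theta>) z = psi s"
    by (simp add: z_def zeta_def \<theta>_def evolve_add_time[OF herm1])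
  then have eta'_eq: "eta' t m s = f2 s *\<^sub>R J (E (\<theta> *\<^sub>R J (comm H1 H2 *v z) - R))"
    unfolding eta'_def E_def \<theta>_def[symmetric] z_def[symmetric] by (simp add: R_def algebra_simps)
  have split: "eta' t m s - ((s - m) * f1 m) *\<^sub>R phi t m s
      = - ((\<theta> - (m - s) * f1 m) *\<^sub>R phi t m s) - f2 s *\<^sub>R J (E R)"
    unfolding eta'_eq phi_def E_def z_def[symmetric]
    by (simp add: evolve_diff[OF herm2] evolve_scaleR[OF herm2] evolve_J[OF herm2] J_simps algebra_simps)
  have "\<bar>\<theta> - (m - s) * f1 m\<bar> \<le> a1 * (s - m)\<^sup>2"
    using F1_taylor_bound[OF s m] by (simp add: \<theta>_def abs_minus_commute algebra_simps)
  moreover have "norm R \<le> C2 * (M_H1 + norm (psi 0)) * (a0\<^sup>2 * (s - m)\<^sup>2)"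
    unfolding R_def \<theta>_def z_def by (rule norm_H2_conj_remainder_zeta_le[OF s m])
  ultimately have "\<bar>\<theta> - (m - s) * f1 m\<bar> * norm (phi t m s) + \<bar>f2 s\<bar> * norm R
      \<le> (a1 * (s - m)\<^sup>2) * (b0 * (2 * C1 * (M_H1 + norm (psi 0))))
        + b0 * (C2 * (M_H1 + norm (psi 0)) * (a0\<^sup>2 * (s - m)\<^sup>2))"
    using norm_phi[OF s] abs_f2_le[OF s] supnorm_nonneg by (intro add_mono mult_mono) auto
  moreover have "norm (eta' t m s - ((s - m) * f1 m) *\<^sub>R phi t m s)
      \<le> \<bar>\<theta> - (m - s) * f1 m\<bar> * norm (phi t m s) + \<bar>f2 s\<bar> * norm R"
    unfolding split by (rule order_trans[OF norm_triangle_ineq4]) (simp add: norm_J E_def evolve_H2_simps)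
  ultimately show ?thesis
    by (simp add: algebra_simps)
qed

lemma norm_eta'_midpoint_le:
  assumes s: "s \<in> {0..T}" and m: "m \<in> {0..T}"
  shows "norm (eta' t m s - ((s - m) * f1 m) *\<^sub>R phi t m m) \<le> K_g2 * (M_H1 + norm (psi 0)) * (s - m)\<^sup>2"
proof -
  let ?M = "M_H1 + norm (psi 0)"
  have "norm (eta' t m s - ((s - m) * f1 m) *\<^sub>R phi t m m)
      \<le> norm (eta' t m s - ((s - m) * f1 m) *\<^sub>R phi t m s)
        + norm (((s - m) * f1 m) *\<^sub>R (phi t m s - phi t m m))"
    by (rule order_trans[OF _ norm_triangle_ineq]) (simp add: algebra_simps)
  also have "\<dots> \<le> (a1 * b0 * (2 * C1) + b0 * C2 * a0\<^sup>2) * ?M * (s - m)\<^sup>2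
      + (\<bar>s - m\<bar> * a0) * (K_phi * ?M * \<bar>s - m\<bar>)"
    unfolding norm_scaleR abs_mult
    using norm_eta'_expansion_le[OF s m] abs_f1_le[OF m] norm_phi_diff_le[OF m s, of t m]
    by (intro add_mono mult_mono mult_left_mono) auto
  also have "(\<bar>s - m\<bar> * a0) * (K_phi * ?M * \<bar>s - m\<bar>) = a0 * K_phi * ?M * (s - m)\<^sup>2"
    by (simp add: power2_eq_square mult_ac)
  finally show ?thesis
    by (simp add: K_g2_def algebra_simps)
qed

lemma step_g2_error_eq_eta_increment:
  assumes t: "0 \<le> t" "0 \<le> h" "t + h \<le> T"
  defines "m \<equiv> t + h / 2"
  shows "norm (step_g2 f1 f2 H1 H2 t h (psi t) - psi (t + h)) = norm (eta t m t - eta t m (t + h))"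
proof -
  have "integral {t..t+h/2} f1 = F1 m - F1 t" "integral {t+h/2..t+h} f1 = F1 (t + h) - F1 m"
    "integral {t..t+h} f2 = F2 (t + h) - F2 t"
    using t by (auto simp: m_def intro!: integral_f1 integral_f2)
  then have step: "step_g2 f1 f2 H1 H2 t h (psi t)
      = evolve H1 (F1 (t + h) - F1 m) (evolve H2 (F2 (t + h) - F2 t) (evolve H1 (F1 m - F1 t) (psi t)))"
    by (simp add: step_g2_evolve m_def)
  have "norm (step_g2 f1 f2 H1 H2 t h (psi t) - psi (t + h))
      = norm (evolve H2 (F2 t - F2 (t + h)) (evolve H1 (F1 m - F1 (t + h))
          (step_g2 f1 f2 H1 H2 t h (psi t) - psi (t + h))))"
    by (simp only: evolve_norm[OF herm1] evolve_norm[OF herm2])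
  also have "\<dots> = norm (eta t m t - eta t m (t + h))"
    unfolding step eta_def zeta_def
    by (simp add: evolve_diff[OF herm1] evolve_diff[OF herm2] evolve_add_time[OF herm1]
        evolve_add_time[OF herm2])
  finally show ?thesis .
qed

lemma local_error_g2:
  assumes t: "0 \<le> t" "0 \<le> h" "t + h \<le> T"
  shows "norm (step_g2 f1 f2 H1 H2 t h (psi t) - psi (t + h)) \<le> K_g2 * h ^ 3 * (M_H1 + norm (psi 0))"
proof -
  let ?M = "M_H1 + norm (psi 0)"
  define m where "m = t + h / 2"
  have mT: "m \<in> {0..T}" and sub: "{t..t+h} \<subseteq> {0..T}"
    and seg: "closed_segment t (t + h) = {t..t+h}"
    using t by (auto simp: m_def closed_segment_eq_real_ivl)
  text \<open>Subtracting the linear-in-\<open>(s - m)\<close> part of \<open>eta'\<close>, frozen at \<open>m\<close>, does not change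
    the increment over \<open>[t, t + h]\<close>.\<close>
  define P where "P s = eta t m s - ((s - m)\<^sup>2 / 2 * f1 m) *\<^sub>R phi t m m" for s
  have "norm (P (t + h) - P t) \<le> (K_g2 * ?M * h\<^sup>2) * \<bar>(t + h) - t\<bar>"
  proof (rule has_vector_derivative_bound, unfold seg)
    fix s assume s: "s \<in> {t..t+h}"
    then have sT: "s \<in> {0..T}" using sub by blast
    have "((\<lambda>s. (s - m)\<^sup>2 / 2 * f1 m) has_real_derivative (s - m) * f1 m) (at s within {t..t+h})"
      by (auto intro!: derivative_eq_intros)
    from has_vector_derivative_scaleR[OF this has_vector_derivative_const[of "phi t m m"]]
      has_vector_derivative_within_subset[OF eta_has_vector_derivative[OF sT] sub]
    show "(P has_vector_derivative eta' t m s - ((s - m) * f1 m) *\<^sub>R phi t m m) (at s within {t..t+h})"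
      unfolding P_def by (auto intro: has_vector_derivative_diff)
    have "\<bar>s - m\<bar> \<le> \<bar>h\<bar>"
      using s t by (auto simp: m_def)
    then have "(s - m)\<^sup>2 \<le> h\<^sup>2"
      by (simp add: abs_le_square_iff)
    then have "K_g2 * ?M * (s - m)\<^sup>2 \<le> K_g2 * ?M * h\<^sup>2"
      by (rule mult_left_mono) (use K_g2_nonneg M_H1_nonneg in simp)
    with norm_eta'_midpoint_le[OF sT mT]
    show "norm (eta' t m s - ((s - m) * f1 m) *\<^sub>R phi t m m) \<le> K_g2 * ?M * h\<^sup>2"
      by (rule order_trans)
  qed
  moreover have "norm (eta t m t - eta t m (t + h)) = norm (P (t + h) - P t)"
    by (simp add: P_def m_def power2_eq_square norm_minus_commute algebra_simps)
  ultimately show ?thesis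
    using step_g2_error_eq_eta_increment[OF t] t
    by (simp add: m_def power3_eq_cube power2_eq_square ac_simps)
qed

lemma comm_evolve_bound_le:
  assumes "norm y = norm (psi 0)" "norm (H1 *v y) \<le> M_H1" "\<bar>b\<bar> \<le> b0 * h" "0 \<le> h" "h \<le> T"
  shows "comm_evolve_bound y b \<le> K_comm * h * (M_H1 + norm (psi 0))"
proof -
  have "norm y + norm (H1 *v y) \<le> 2 * M_H1 + 2 * norm y"
    using assms(2) M_H1_nonneg norm_ge_zero[of y] by linarith
  then have "(norm y + norm (H1 *v y)) / 2 \<le> M_H1 + norm y"
    by (simp add: field_simps)
  then have "C1 * ((norm y + norm (H1 *v y)) / 2 + norm y * (2 + C1 * \<bar>b\<bar>)) * \<bar>b\<bar> \<le> K_comm * h * (M_H1 + norm y)"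
    using assms M_H1_nonneg by (intro commutator_growth_le) auto
  then show ?thesis by (simp add: comm_evolve_bound_def assms(1))
qed

lemma norm_splitting_perturbation_bound:
  assumes y: "norm y = norm (psi 0)" "norm (H1 *v y) \<le> M_H1" and h: "0 \<le> h" "h \<le> T"
    and b: "\<bar>b\<bar> \<le> b0 * h"
    and errors: "\<bar>\<epsilon>\<bar> \<le> a2 * h ^ 3" "\<bar>\<delta>\<bar> \<le> a1 * h\<^sup>2" "\<bar>b - \<beta>\<bar> \<le> b2 * h ^ 3"
  shows "norm (evolve H1 (\<alpha> + \<epsilon>) (evolve H1 (- \<delta>) (evolve H2 b (evolve H1 \<delta> y))) - evolve H1 \<alpha> (evolve H2 \<beta> y))
    \<le> (a2 * (1 + K_comm * T) + K_comm * a1 + opnorm H2 * b2) * h ^ 3 * (M_H1 + norm (psi 0))"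
proof -
  let ?M = "M_H1 + norm (psi 0)"
  have Q: "comm_evolve_bound y b \<le> K_comm * h * ?M"
    by (rule comm_evolve_bound_le[OF y b h])
  have "\<bar>\<epsilon>\<bar> * (norm (H1 *v y) + comm_evolve_bound y b) \<le> (a2 * h ^ 3) * ((1 + K_comm * T) * ?M)"
  proof (rule mult_mono[OF errors(1)])
    have "K_comm * h * ?M \<le> K_comm * T * ?M"
      using K_comm_nonneg M_H1_nonneg h by (intro mult_right_mono mult_left_mono) auto
    moreover have "(1 + K_comm * T) * ?M = M_H1 + norm (psi 0) + K_comm * T * ?M"
      by (simp add: algebra_simps)
    ultimately show "norm (H1 *v y) + comm_evolve_bound y b \<le> (1 + K_comm * T) * ?M"
      using y Q norm_ge_zero[of "psi 0"] by linarith
  qed (use supnorm_nonneg comm_evolve_bound_nonneg[of y b] h in auto)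
  moreover have "comm_evolve_bound y b * \<bar>\<delta>\<bar> \<le> (K_comm * h * ?M) * (a1 * h\<^sup>2)"
    using Q errors(2) K_comm_nonneg M_H1_nonneg comm_evolve_bound_nonneg h by (intro mult_mono) auto
  moreover have "opnorm H2 * norm y * \<bar>b - \<beta>\<bar> \<le> (opnorm H2 * ?M) * (b2 * h ^ 3)"
    using errors(3) y M_H1_nonneg opnorm_nonneg[of H2] by (intro mult_mono mult_left_mono) auto
  ultimately show ?thesis
    using norm_splitting_perturbation_le[of \<alpha> \<epsilon> \<delta> b y \<beta>]
    by (simp add: power2_eq_square power3_eq_cube algebra_simps)
qed

text \<open>The standard Strang step differs from the generalized one by phase errors of order \<open>h\<^sup>3\<close>
  (midpoint rule) and by the displacement \<open>\<delta> = O(h\<^sup>2)\<close> of the inner \<open>H2\<close>-factor, which costs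
  a commutator of order \<open>h\<close>.\<close>

lemma local_error_s2:
  assumes t: "0 \<le> t" "0 \<le> h" "t + h \<le> T"
  shows "norm (step_s2 f1 f2 H1 H2 t h (psi t) - psi (t + h)) \<le> K_s2 * h ^ 3 * (M_H1 + norm (psi 0))"
proof -
  define m where "m = t + h / 2"
  define \<alpha> where "\<alpha> = h / 2 * f1 m"
  define y where "y = evolve H1 \<alpha> (psi t)"
  define \<delta> where "\<delta> = F1 m - F1 t - \<alpha>"
  define \<epsilon> where "\<epsilon> = F1 (t + h) - F1 t - h * f1 m"
  define b where "b = F2 (t + h) - F2 t"
  define \<beta> where "\<beta> = h * f2 m"
  have tT: "t \<in> {0..T}" and thT: "t + h \<in> {0..T}" using t by auto
  have "integral {t..t+h/2} f1 = F1 m - F1 t" "integral {t+h/2..t+h} f1 = F1 (t + h) - F1 m"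
    "integral {t..t+h} f2 = b"
    using t by (auto simp: m_def b_def intro!: integral_f1 integral_f2)
  then have "step_g2 f1 f2 H1 H2 t h (psi t)
      = evolve H1 (F1 (t + h) - F1 m) (evolve H2 b (evolve H1 (F1 m - F1 t) (psi t)))"
    by (simp add: step_g2_evolve m_def)
  also have "\<dots> = evolve H1 (\<alpha> + \<epsilon> + - \<delta>) (evolve H2 b (evolve H1 (\<delta> + \<alpha>) (psi t)))"
    by (simp add: \<alpha>_def \<epsilon>_def \<delta>_def algebra_simps)
  finally have "step_g2 f1 f2 H1 H2 t h (psi t)
      = evolve H1 (\<alpha> + \<epsilon>) (evolve H1 (- \<delta>) (evolve H2 b (evolve H1 \<delta> y)))"
    by (simp add: y_def evolve_add_time[OF herm1])
  moreover have "step_s2 f1 f2 H1 H2 t h (psi t) = evolve H1 \<alpha> (evolve H2 \<beta> y)"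
    by (simp add: step_s2_evolve \<alpha>_def \<beta>_def y_def m_def)
  moreover have "norm y = norm (psi 0)" "norm (H1 *v y) \<le> M_H1"
    by (simp_all add: y_def evolve_H1_simps norm_psi[OF tT] norm_H1_evolve_H1 norm_H1_psi_le[OF tT])
  moreover have "\<bar>b\<bar> \<le> b0 * h"
    using abs_F2_diff_le[OF thT tT] t by (simp add: b_def)
  moreover have "\<bar>\<epsilon>\<bar> \<le> a2 * h ^ 3" "\<bar>\<delta>\<bar> \<le> a1 * h\<^sup>2" "\<bar>b - \<beta>\<bar> \<le> b2 * h ^ 3"
    using midpoint_phase_errors[OF t] by (simp_all add: \<epsilon>_def \<delta>_def \<alpha>_def b_def \<beta>_def m_def)
  ultimately have "norm (step_g2 f1 f2 H1 H2 t h (psi t) - step_s2 f1 f2 H1 H2 t h (psi t))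
      \<le> (a2 * (1 + K_comm * T) + K_comm * a1 + opnorm H2 * b2) * h ^ 3 * (M_H1 + norm (psi 0))"
    using t by (simp add: norm_splitting_perturbation_bound)
  then show ?thesis
    using local_error_g2[OF t] norm_triangle_ineq4[of "step_g2 f1 f2 H1 H2 t h (psi t) - psi (t + h)"
        "step_g2 f1 f2 H1 H2 t h (psi t) - step_s2 f1 f2 H1 H2 t h (psi t)"]
    by (simp add: K_s2_def algebra_simps)
qed

lemma step_s1_isometry: "norm (step_s1 f1 f2 H1 H2 t h x - step_s1 f1 f2 H1 H2 t h y) = norm (x - y)"
  by (simp add: step_s1_evolve evolve_H1_simps evolve_H2_simps flip: evolve_diff[OF herm1] evolve_diff[OF herm2])

lemma step_g1_isometry: "norm (step_g1 f1 f2 H1 H2 t h x - step_g1 f1 f2 H1 H2 t h y) = norm (x - y)"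
  by (simp add: step_g1_evolve evolve_H1_simps evolve_H2_simps flip: evolve_diff[OF herm1] evolve_diff[OF herm2])

lemma step_s2_isometry: "norm (step_s2 f1 f2 H1 H2 t h x - step_s2 f1 f2 H1 H2 t h y) = norm (x - y)"
  by (simp add: step_s2_evolve evolve_H1_simps evolve_H2_simps flip: evolve_diff[OF herm1] evolve_diff[OF herm2])

lemma step_g2_isometry: "norm (step_g2 f1 f2 H1 H2 t h x - step_g2 f1 f2 H1 H2 t h y) = norm (x - y)"
  by (simp add: step_g2_evolve evolve_H1_simps evolve_H2_simps flip: evolve_diff[OF herm1] evolve_diff[OF herm2])

lemma global_error_bounds:
  assumes "L \<ge> 1"
  shows "norm (steps (step_s1 f1 f2 H1 H2) L (T / real L) (psi 0) - psi T)
      \<le> K_s1 * (T\<^sup>2 / real L) * (M_H1 + norm (psi 0))"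
    and "norm (steps (step_g1 f1 f2 H1 H2) L (T / real L) (psi 0) - psi T)
      \<le> K_g1 * (T\<^sup>2 / real L) * (M_sqrt + norm (psi 0))"
    and "norm (steps (step_s2 f1 f2 H1 H2) L (T / real L) (psi 0) - psi T)
      \<le> K_s2 * (T ^ 3 / (real L)\<^sup>2) * (M_H1 + norm (psi 0))"
    and "norm (steps (step_g2 f1 f2 H1 H2) L (T / real L) (psi 0) - psi T)
      \<le> K_g2 * (T ^ 3 / (real L)\<^sup>2) * (M_H1 + norm (psi 0))"
  using steps_error_le[OF T_pos assms _ step_s1_isometry local_error_s1]
    steps_error_le[OF T_pos assms _ step_g1_isometry local_error_g1]
    steps_error_le[OF T_pos assms _ step_s2_isometry local_error_s2]
    steps_error_le[OF T_pos assms _ step_g2_isometry local_error_g2]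
  by simp_all

end

context trotter_data
begin

definition K_max :: real where "K_max = max (max K_s1 K_g1) (max K_s2 K_g2)"

lemma trotter_error_bounds:
  fixes H1 D1 :: "complex ^ 'n ^ 'n" and psi :: "real \<Rightarrow> complex ^ 'n"
  assumes "hermitian H1" "H1 = adj D1 ** D1"
    and "\<And>v. norm (comm H1 H2 *v v) \<le> C1 * (norm (D1 *v v) + norm v)"
    and "\<And>v. norm (comm H1 (comm H1 H2) *v v) \<le> C2 * (norm (H1 *v v) + norm v)"
    and "\<And>t. t \<in> {0..T} \<Longrightarrow>
      (psi has_vector_derivative (- \<i>) *s ((f1 t *\<^sub>R H1 + f2 t *\<^sub>R H2) *v psi t)) (at t within {0..T})"
    and L: "L \<ge> 1"
  shows "norm (steps (step_s1 f1 f2 H1 H2) L (T / real L) (psi 0) - psi T)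
       \<le> K_max * (T ^ 2 / real L) * ((SUP t\<in>{0..T}. norm (H1 *v psi t)) + norm (psi 0)) \<and>
     norm (steps (step_g1 f1 f2 H1 H2) L (T / real L) (psi 0) - psi T)
       \<le> K_max * (T ^ 2 / real L) * ((SUP t\<in>{0..T}. sqrt (norm (psi 0) * norm (H1 *v psi t))) + norm (psi 0)) \<and>
     norm (steps (step_s2 f1 f2 H1 H2) L (T / real L) (psi 0) - psi T)
       \<le> K_max * (T ^ 3 / (real L) ^ 2) * ((SUP t\<in>{0..T}. norm (H1 *v psi t)) + norm (psi 0)) \<and>
     norm (steps (step_g2 f1 f2 H1 H2) L (T / real L) (psi 0) - psi T)
       \<le> K_max * (T ^ 3 / (real L) ^ 2) * ((SUP t\<in>{0..T}. norm (H1 *v psi t)) + norm (psi 0))"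
proof -
  interpret trotter_instance T f1 f2 f1' f2' f1'' f2'' H2 H1 D1 C1 C2 psi
    using assms herm2 C1_nonneg C2_nonneg by unfold_locales auto
  have "0 \<le> M_H1 + norm (psi 0)" "0 \<le> M_sqrt + norm (psi 0)"
    using M_H1_nonneg M_sqrt_nonneg by auto
  then show ?thesis
    unfolding M_H1_def[symmetric] M_sqrt_def[symmetric]
    by (intro conjI le_mult_mono_const[OF global_error_bounds(1)[OF L]]
        le_mult_mono_const[OF global_error_bounds(2)[OF L]]
        le_mult_mono_const[OF global_error_bounds(3)[OF L]]
        le_mult_mono_const[OF global_error_bounds(4)[OF L]])
      (use T_pos in \<open>simp_all add: K_max_def le_max_iff_disj\<close>)
qed

end

theorem theorem4:
  fixes T C1 C2 :: real
    and f1 f2 f1' f2' f1'' f2'' :: "real \<Rightarrow> real"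
    and H2 :: "complex ^ ('n::finite) ^ 'n"
  assumes T: "T > 0"
    and d1: "\<And>t. t \<in> {0..T} \<Longrightarrow> (f1 has_real_derivative f1' t) (at t within {0..T})"
    and dd1: "\<And>t. t \<in> {0..T} \<Longrightarrow> (f1' has_real_derivative f1'' t) (at t within {0..T})"
    and c1: "continuous_on {0..T} f1''"
    and d2: "\<And>t. t \<in> {0..T} \<Longrightarrow> (f2 has_real_derivative f2' t) (at t within {0..T})"
    and dd2: "\<And>t. t \<in> {0..T} \<Longrightarrow> (f2' has_real_derivative f2'' t) (at t within {0..T})"
    and c2: "continuous_on {0..T} f2''"
    and herm2: "hermitian H2"
    and C1: "C1 \<ge> 0" and C2: "C2 \<ge> 0"
  shows "\<exists>C. \<forall>(H1 :: complex ^ 'n ^ 'n) (D1 :: complex ^ 'n ^ 'n) (psi :: real \<Rightarrow> complex ^ 'n) (L :: nat).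
     hermitian H1 \<longrightarrow> H1 = adj D1 ** D1 \<longrightarrow>
     (\<forall>v. norm (comm H1 H2 *v v) \<le> C1 * (norm (D1 *v v) + norm v)) \<longrightarrow>
     (\<forall>v. norm (comm H1 (comm H1 H2) *v v) \<le> C2 * (norm (H1 *v v) + norm v)) \<longrightarrow>
     (\<forall>t\<in>{0..T}. (psi has_vector_derivative
          (- \<i>) *s ((f1 t *\<^sub>R H1 + f2 t *\<^sub>R H2) *v psi t)) (at t within {0..T})) \<longrightarrow>
     L \<ge> 1 \<longrightarrow>
     2 * (T / real L) * (supnorm T f1 + supnorm T f2) * (C1 + opnorm H2) \<le> 1 \<longrightarrow>
     norm (steps (step_s1 f1 f2 H1 H2) L (T / real L) (psi 0) - psi T)
       \<le> C * (T ^ 2 / real L) * ((SUP t\<in>{0..T}. norm (H1 *v psi t)) + norm (psi 0)) \<and>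
     norm (steps (step_g1 f1 f2 H1 H2) L (T / real L) (psi 0) - psi T)
       \<le> C * (T ^ 2 / real L) * ((SUP t\<in>{0..T}. sqrt (norm (psi 0) * norm (H1 *v psi t))) + norm (psi 0)) \<and>
     norm (steps (step_s2 f1 f2 H1 H2) L (T / real L) (psi 0) - psi T)
       \<le> C * (T ^ 3 / (real L) ^ 2) * ((SUP t\<in>{0..T}. norm (H1 *v psi t)) + norm (psi 0)) \<and>
     norm (steps (step_g2 f1 f2 H1 H2) L (T / real L) (psi 0) - psi T)
       \<le> C * (T ^ 3 / (real L) ^ 2) * ((SUP t\<in>{0..T}. norm (H1 *v psi t)) + norm (psi 0))"
proof -
  interpret trotter_data T f1 f2 f1' f2' f1'' f2'' H2 C1 C2
    by unfold_locales (use assms in auto)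
  show ?thesis
    by (intro exI[of _ K_max] allI impI trotter_error_bounds) auto
qed

end
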